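(* Let $\pmb k$ be a field, $B=\pmb k[x,y]$, and $d$ a positive integer. The subset $\mathbb T_d$ of $\mathbb A_d$ is open, where $\mathbb A_d=B_d\times B_d\times B_d$ and $\mathbb T_d$ is the set of $\pmb g\in\mathbb A_d$ for which the rational map $\Psi_{\pmb g}:\mathbb P^1\dashrightarrow\mathbb P^2$ is birational (onto its image) and has no base points.
   Context: $B=\pmb k[x,y]$ is the standard graded polynomial ring and $B_d$ is its degree $d$ component. $\mathbb A_d$ consists of ordered triples $\pmb g=(g_1,g_2,g_3)$ of homogeneous forms of degree $d$; it is identified with affine space $\mathbb A^{3d+3}$ by means of the coefficients of $g_1,g_2,g_3$ and is given the Zariski topology. For $\pmb g\in\mathbb A_d$, $I_{\pmb g}=(g_1,g_2,g_3)B$ and $\Psi_{\pmb g}:\mathbb P^1\setminus V(I_{\pmb g})\to\mathbb P^2$ is the morphism $q\mapsto[g_1(q):g_2(q):g_3(q)]$. The map $\Psi_{\pmb g}$ is base point free if and only if $\operatorname{ht}I_{\pmb g}=2$, and "birational" means birational onto the closure $\mathcal C_{\pmb g}$ of its image. *)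

theory Defs
  imports
    "HOL-Analysis.Abstract_Topology"
    "HOL-Library.Poly_Mapping"
    "HOL-Library.Numeral_Type"
    "HOL-Algebra.Ideal"
    "HOL-Algebra.Algebraic_Closure_Type"
begin

section \<open>Polynomial rings in several variables\<close>

text \<open>\<open>('v, 'a) mpoly\<close> is the polynomial ring over \<open>'a\<close> whose variables are the elements of
  \<open>'v\<close>; in particular \<open>(2, 'a) mpoly\<close> is $B = k[x,y]$ and \<open>(3, 'a) mpoly\<close> is the homogeneous
  coordinate ring of the projective plane.\<close>

type_synonym ('v, 'a) mpoly = "('v \<Rightarrow>\<^sub>0 nat) \<Rightarrow>\<^sub>0 'a"

definition Var :: "'v \<Rightarrow> ('v, 'a::zero_neq_one) mpoly" where
  "Var i = Poly_Mapping.single (Poly_Mapping.single i 1) 1"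

definition Const :: "'a \<Rightarrow> ('v, 'a::zero) mpoly" where
  "Const c = Poly_Mapping.single 0 c"

definition mdeg :: "('v \<Rightarrow>\<^sub>0 nat) \<Rightarrow> nat" where
  "mdeg m = (\<Sum>i\<in>Poly_Mapping.keys m. Poly_Mapping.lookup m i)"

definition vars :: "('v, 'a::zero) mpoly \<Rightarrow> 'v set" where
  "vars p = (\<Union>m\<in>Poly_Mapping.keys p. Poly_Mapping.keys m)"

text \<open>As usual, the zero polynomial is a form of every degree.\<close>

definition is_form :: "nat \<Rightarrow> ('v, 'a::zero) mpoly \<Rightarrow> bool" where
  "is_form e p \<longleftrightarrow> (\<forall>m\<in>Poly_Mapping.keys p. mdeg m = e)"

definition mono_eval :: "('v \<Rightarrow> 'b::comm_semiring_1) \<Rightarrow> ('v \<Rightarrow>\<^sub>0 nat) \<Rightarrow> 'b" where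
  "mono_eval v m = (\<Prod>i\<in>Poly_Mapping.keys m. v i ^ Poly_Mapping.lookup m i)"

text \<open>The substitution of \<open>v\<close> for the variables, where \<open>h\<close> embeds the coefficients.\<close>

definition eval_hom :: "('a::zero \<Rightarrow> 'b::comm_semiring_1) \<Rightarrow> ('v \<Rightarrow> 'b) \<Rightarrow> ('v, 'a) mpoly \<Rightarrow> 'b" where
  "eval_hom h v p = (\<Sum>m\<in>Poly_Mapping.keys p. h (Poly_Mapping.lookup p m) * mono_eval v m)"

definition eval_at :: "('v \<Rightarrow> 'a::comm_semiring_1) \<Rightarrow> ('v, 'a) mpoly \<Rightarrow> 'a" where
  "eval_at v = eval_hom (\<lambda>c. c) v"

definition subst :: "('v \<Rightarrow> ('w, 'a) mpoly) \<Rightarrow> ('v, 'a) mpoly \<Rightarrow> ('w, 'a::comm_semiring_1) mpoly" where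
  "subst f = eval_hom Const f"


section \<open>Projective space over a field\<close>

text \<open>Projective space is the scheme \<open>Proj\<close> of the polynomial ring, so that its points,
  closed subsets and closures have the intended meaning over an arbitrary (possibly finite)
  field.\<close>

definition homogeneous_ideal :: "('v, 'a::field) mpoly set \<Rightarrow> bool" where
  "homogeneous_ideal P \<longleftrightarrow> genideal ring_of_type_algebra {p \<in> P. \<exists>e. is_form e p} = P"

definition Proj :: "('v, 'a::field) mpoly set set" where
  "Proj = {P. primeideal P ring_of_type_algebra \<and> homogeneous_ideal P \<and> \<not> range Var \<subseteq> P}"

definition Proj_zeros :: "('v, 'a::field) mpoly set \<Rightarrow> ('v, 'a) mpoly set set" where
  "Proj_zeros S = {P \<in> Proj. S \<subseteq> P}"

definition Proj_closure :: "('v, 'a::field) mpoly set set \<Rightarrow> ('v, 'a) mpoly set set" where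
  "Proj_closure Z = \<Inter>{Proj_zeros S | S. Z \<subseteq> Proj_zeros S}"

definition vanishing_ideal :: "('v, 'a::field) mpoly set set \<Rightarrow> ('v, 'a) mpoly set" where
  "vanishing_ideal Z = \<Inter>Z"


section \<open>Rational maps between integral projective schemes\<close>

text \<open>In this section \<open>J\<close> and \<open>J'\<close> are the (homogeneous prime) ideals of closed integral
  subschemes $X$ and $Y$ of two projective spaces. A rational map $X \dashrightarrow Y$ is
  given by a tuple of forms of one common degree that do not all vanish on $X$ and that satisfy
  the equations of $Y$. Two tuples give the same rational map if they are proportional
  over the homogeneous coordinate ring of $X$.\<close>

definition rational_map ::
    "('v, 'a::field) mpoly set \<Rightarrow> ('w, 'a) mpoly set \<Rightarrow> ('w \<Rightarrow> ('v, 'a) mpoly) \<Rightarrow> bool" where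
  "rational_map J J' f \<longleftrightarrow>
     (\<exists>e. \<forall>i. is_form e (f i)) \<and> (\<exists>i. f i \<notin> J) \<and> (\<forall>F\<in>J'. subst f F \<in> J)"

definition same_rational_map ::
    "('v, 'a::field) mpoly set \<Rightarrow> ('w \<Rightarrow> ('v, 'a) mpoly) \<Rightarrow> ('w \<Rightarrow> ('v, 'a) mpoly) \<Rightarrow> bool" where
  "same_rational_map J f f' \<longleftrightarrow> (\<forall>i j. f i * f' j - f j * f' i \<in> J)"

definition comp_map ::
    "('w \<Rightarrow> ('v, 'a::field) mpoly) \<Rightarrow> ('u \<Rightarrow> ('w, 'a) mpoly) \<Rightarrow> 'u \<Rightarrow> ('v, 'a) mpoly" where
  "comp_map f f' = (\<lambda>i. subst f (f' i))"

text \<open>\<open>Var\<close> represents the identity; requiring the composites to be rational maps says that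
  the compositions are defined.\<close>

definition birational_map ::
    "('v, 'a::field) mpoly set \<Rightarrow> ('w, 'a) mpoly set \<Rightarrow> ('w \<Rightarrow> ('v, 'a) mpoly) \<Rightarrow> bool" where
  "birational_map J J' f \<longleftrightarrow> rational_map J J' f \<and>
     (\<exists>h. rational_map J' J h \<and>
          rational_map J J (comp_map f h) \<and> same_rational_map J (comp_map f h) Var \<and>
          rational_map J' J' (comp_map h f) \<and> same_rational_map J' (comp_map h f) Var)"


section \<open>Parametrized rational plane curves\<close>

definition triples :: "nat \<Rightarrow> (3 \<Rightarrow> (2, 'a::field) mpoly) set" where
  "triples d = {g. \<forall>i. is_form d (g i)}"

definition ideal_of :: "(3 \<Rightarrow> (2, 'a::field) mpoly) \<Rightarrow> (2, 'a) mpoly set" where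
  "ideal_of g = genideal ring_of_type_algebra (range g)"

definition base_points :: "(3 \<Rightarrow> (2, 'a::field) mpoly) \<Rightarrow> (2, 'a) mpoly set set" where
  "base_points g = Proj_zeros (ideal_of g)"

text \<open>The morphism $q \mapsto [g_1(q):g_2(q):g_3(q)]$ on scheme points: the image of the
  homogeneous prime \<open>q\<close> is its contraction along $T_i \mapsto g_i$.\<close>

definition Psi :: "(3 \<Rightarrow> (2, 'a::field) mpoly) \<Rightarrow> (2, 'a) mpoly set \<Rightarrow> (3, 'a) mpoly set" where
  "Psi g q = subst g -` q"

definition image_closure :: "(3 \<Rightarrow> (2, 'a::field) mpoly) \<Rightarrow> (3, 'a) mpoly set set" where
  "image_closure g = Proj_closure (Psi g ` (Proj - base_points g))"

definition birational_onto_image :: "(3 \<Rightarrow> (2, 'a::field) mpoly) \<Rightarrow> bool" where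
  "birational_onto_image g \<longleftrightarrow> birational_map (vanishing_ideal Proj) (vanishing_ideal (image_closure g)) g"

definition birational_bpf :: "nat \<Rightarrow> (3 \<Rightarrow> (2, 'a::field) mpoly) set" where
  "birational_bpf d = {g \<in> triples d. birational_onto_image g \<and> base_points g = {}}"


section \<open>The Zariski topology on the space of triples\<close>

text \<open>The coordinates of affine $(3d+3)$-space are indexed by pairs \<open>(i, m)\<close> of an index
  \<open>i\<close> and one of the $d+1$ monomials \<open>m\<close> of degree \<open>d\<close> in two variables.\<close>

definition coeffs :: "(3 \<Rightarrow> (2, 'a::field) mpoly) \<Rightarrow> 3 \<times> (2 \<Rightarrow>\<^sub>0 nat) \<Rightarrow> 'a" where
  "coeffs g = (\<lambda>(i, m). Poly_Mapping.lookup (g i) m)"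

definition coord_ring :: "nat \<Rightarrow> (3 \<times> (2 \<Rightarrow>\<^sub>0 nat), 'a::field) mpoly set" where
  "coord_ring d = {P. vars P \<subseteq> UNIV \<times> {m. mdeg m = d}}"

definition coeff_zeros ::
    "nat \<Rightarrow> (3 \<times> (2 \<Rightarrow>\<^sub>0 nat), 'a::field) mpoly set \<Rightarrow> (3 \<Rightarrow> (2, 'a) mpoly) set" where
  "coeff_zeros d S = {g \<in> triples d. \<forall>P\<in>S. eval_at (coeffs g) P = 0}"

definition zariski :: "nat \<Rightarrow> (3 \<Rightarrow> (2, 'a::field) mpoly) topology" where
  "zariski d = topology (\<lambda>U. U \<subseteq> triples d \<and> (\<exists>S \<subseteq> coord_ring d. triples d - U = coeff_zeros d S))"

lemma mono_eval_superset:
  assumes "finite K" "Poly_Mapping.keys m \<subseteq> K"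
  shows "mono_eval v m = (\<Prod>i\<in>K. v i ^ Poly_Mapping.lookup m i)"
  unfolding mono_eval_def
  by (rule prod.mono_neutral_left) (use assms in \<open>auto simp: in_keys_iff\<close>)

lemma mono_eval_add: "mono_eval v (m + n) = mono_eval v m * mono_eval v n"
proof -
  let ?K = "Poly_Mapping.keys m \<union> Poly_Mapping.keys n"
  have "mono_eval v (m + n) = (\<Prod>i\<in>?K. v i ^ Poly_Mapping.lookup (m + n) i)"
    by (rule mono_eval_superset) (use Poly_Mapping.keys_add[of m n] in auto)
  also have "\<dots> = (\<Prod>i\<in>?K. v i ^ Poly_Mapping.lookup m i) * (\<Prod>i\<in>?K. v i ^ Poly_Mapping.lookup n i)"
    by (simp add: lookup_add power_add prod.distrib)
  also have "\<dots> = mono_eval v m * mono_eval v n"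
    by (simp add: mono_eval_superset[of ?K m] mono_eval_superset[of ?K n])
  finally show ?thesis .
qed

lemma eval_at_superset:
  assumes "finite K" "Poly_Mapping.keys p \<subseteq> K"
  shows "eval_at v p = (\<Sum>m\<in>K. Poly_Mapping.lookup p m * mono_eval v m)"
  unfolding eval_at_def eval_hom_def
  by (rule sum.mono_neutral_left) (use assms in \<open>auto simp: in_keys_iff\<close>)

lemma eval_at_0 [simp]: "eval_at v 0 = 0"
  by (simp add: eval_at_def eval_hom_def)

lemma eval_at_add: "eval_at v (p + q) = eval_at v p + eval_at v q"
proof -
  let ?K = "Poly_Mapping.keys p \<union> Poly_Mapping.keys q"
  have "eval_at v (p + q) = (\<Sum>m\<in>?K. Poly_Mapping.lookup (p + q) m * mono_eval v m)"
    by (rule eval_at_superset) (use Poly_Mapping.keys_add[of p q] in auto)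
  also have "\<dots> = eval_at v p + eval_at v q"
    by (simp add: lookup_add algebra_simps sum.distrib
        eval_at_superset[of ?K p] eval_at_superset[of ?K q])
  finally show ?thesis .
qed

lemma eval_at_sum: "eval_at v (sum f K) = (\<Sum>x\<in>K. eval_at v (f x))"
  by (induction K rule: infinite_finite_induct) (simp_all add: eval_at_add)

lemma eval_at_single: "eval_at v (Poly_Mapping.single m c) = c * mono_eval v m"
  by (simp add: eval_at_superset[of "{m}"])

lemma mpoly_expand:
  "(p :: ('v, 'a::comm_semiring_1) mpoly) =
     (\<Sum>m\<in>Poly_Mapping.keys p. Poly_Mapping.single m (Poly_Mapping.lookup p m))"
  by (rule poly_mapping_eqI)
    (auto simp: lookup_sum lookup_single when_def in_keys_iff sum.delta cong: if_cong)

lemma eval_at_mult: "eval_at v (p * q) = eval_at v p * eval_at v q"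
proof -
  let ?l = Poly_Mapping.lookup and ?s = Poly_Mapping.single
  have "p * q = (\<Sum>m\<in>Poly_Mapping.keys p. \<Sum>n\<in>Poly_Mapping.keys q.
      ?s (m + n) (?l p m * ?l q n))"
    by (subst mpoly_expand[of p], subst mpoly_expand[of q])
      (simp add: sum_product mult_single)
  hence "eval_at v (p * q) = (\<Sum>m\<in>Poly_Mapping.keys p. \<Sum>n\<in>Poly_Mapping.keys q.
      (?l p m * mono_eval v m) * (?l q n * mono_eval v n))"
    by (simp add: eval_at_sum eval_at_single mono_eval_add mult_ac)
  also have "\<dots> = eval_at v p * eval_at v q"
    by (simp add: eval_at_def eval_hom_def sum_product)
  finally show ?thesis .
qed

lemma vars_mult: "vars (p * q) \<subseteq> vars p \<union> vars q"
proof
  fix i assume "i \<in> vars (p * q)"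
  then obtain m where m: "m \<in> Poly_Mapping.keys (p * q)" "i \<in> Poly_Mapping.keys m"
    by (auto simp: vars_def)
  then obtain a b where "m = a + b" "a \<in> Poly_Mapping.keys p" "b \<in> Poly_Mapping.keys q"
    using Poly_Mapping.keys_mult[of p q] by auto
  with m show "i \<in> vars p \<union> vars q"
    using Poly_Mapping.keys_add[of a b] by (auto simp: vars_def)
qed

lemma istopology_zariski:
  "istopology (\<lambda>U. U \<subseteq> triples d \<and>
     (\<exists>S \<subseteq> coord_ring d. triples d - U = (coeff_zeros d S :: (3 \<Rightarrow> (2, 'a::field) mpoly) set)))"
  unfolding istopology_def
proof (intro conjI allI impI)
  fix U V :: "(3 \<Rightarrow> (2, 'a) mpoly) set"
  assume U: "U \<subseteq> triples d \<and> (\<exists>S \<subseteq> coord_ring d. triples d - U = coeff_zeros d S)"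
    and V: "V \<subseteq> triples d \<and> (\<exists>S \<subseteq> coord_ring d. triples d - V = coeff_zeros d S)"
  show "U \<inter> V \<subseteq> triples d" using U by auto
  obtain S R where S: "S \<subseteq> coord_ring d" "triples d - U = coeff_zeros d S"
    and R: "R \<subseteq> coord_ring d" "triples d - V = coeff_zeros d R" using U V by blast
  let ?Q = "{P * Q | P Q. P \<in> S \<and> Q \<in> R}"
  have "?Q \<subseteq> coord_ring d"
  proof
    fix W assume "W \<in> ?Q"
    then obtain P Q where W: "W = P * Q" "P \<in> coord_ring d" "Q \<in> coord_ring d"
      using S R by blast
    thus "W \<in> coord_ring d" using vars_mult[of P Q] unfolding coord_ring_def by blast
  qed
  moreover have "coeff_zeros d ?Q = coeff_zeros d S \<union> coeff_zeros d R"
    unfolding coeff_zeros_def by (auto simp: eval_at_mult) (metis mult_eq_0_iff eval_at_mult)+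
  hence "triples d - U \<inter> V = coeff_zeros d ?Q" using S R by blast
  ultimately show "\<exists>S \<subseteq> coord_ring d. triples d - U \<inter> V = coeff_zeros d S" by blast
next
  fix \<U> :: "(3 \<Rightarrow> (2, 'a) mpoly) set set"
  assume \<U>: "\<forall>U\<in>\<U>. U \<subseteq> triples d \<and> (\<exists>S \<subseteq> coord_ring d. triples d - U = coeff_zeros d S)"
  then show "\<Union>\<U> \<subseteq> triples d" by blast
  from \<U> obtain S where S: "\<And>U. U \<in> \<U> \<Longrightarrow> S U \<subseteq> coord_ring d \<and> triples d - U = coeff_zeros d (S U)"
    by metis
  have "triples d - \<Union>\<U> = coeff_zeros d (\<Union>(S ` \<U>))"
  proof -
    have "g \<in> coeff_zeros d (\<Union>(S ` \<U>)) \<longleftrightarrow> g \<in> triples d \<and> (\<forall>U\<in>\<U>. g \<in> coeff_zeros d (S U))" for g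
      by (auto simp: coeff_zeros_def)
    thus ?thesis using S by blast
  qed
  moreover have "\<Union>(S ` \<U>) \<subseteq> coord_ring d" using S by blast
  ultimately show "\<exists>S \<subseteq> coord_ring d. triples d - \<Union>\<U> = coeff_zeros d S" by blast
qed

lemma openin_zariski:
  "openin (zariski d) U \<longleftrightarrow> U \<subseteq> triples d \<and> (\<exists>S \<subseteq> coord_ring d. triples d - U = coeff_zeros d S)"
  unfolding zariski_def by (simp add: topology_inverse' istopology_zariski)

end

theory Submission
  imports Defs "Jordan_Normal_Form.Char_Poly"
begin

text \<open>
  Dehomogenizing the forms \<open>g\<^sub>1, g\<^sub>2, g\<^sub>3\<close> gives polynomials \<open>G\<^sub>1, G\<^sub>2, G\<^sub>3\<close> in \<open>k[t]\<close> of degree at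
  most \<open>d\<close>. Both conditions on the triple say that some family of polynomials, whose coefficients
  are polynomial in the coefficients of \<open>g\<close>, has maximal rank in some degree. Maximal rank means
  that some minor is nonzero, and this is an open condition. The degree need not be bounded: each
  degree contributes an open set, and a union of open sets is open.

  By the Nullstellensatz there are no base points iff a power of each variable lies
  in \<open>I\<^bsub>g\<^esub>\<close>, that is, iff the multiples of the three forms span all forms of some degree \<open>n\<close>
  (lemmas \<open>base_point_free_imp_minor\<close> and \<open>minor_imp_base_point_free\<close>).

  The image closure has ideal \<open>J'\<close>, the kernel of \<open>T\<^sub>i \<mapsto> g\<^sub>i\<close>. So a rational
  inverse is a pair of forms \<open>h\<^sub>0, h\<^sub>1\<close> in \<open>k[T\<^sub>1,T\<^sub>2,T\<^sub>3]\<close> with \<open>h\<^sub>0(g) y = h\<^sub>1(g) x \<noteq> 0\<close> (lemma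
  \<open>birational_onto_image_iff\<close>). Consider the Koszul relations
  \<open>\<Delta>\<^sub>i\<^sub>j = G\<^sub>i(t) G\<^sub>j(s) - G\<^sub>j(t) G\<^sub>i(s)\<close> in \<open>k[t][s]\<close> and their multiples of degree at most \<open>N\<close>
  in \<open>s\<close>. All vanish at \<open>s = t\<close>, so their rank over \<open>k(t)\<close> is at most \<open>N\<close>. For a triple without
  base points, birationality means that the rank is \<open>N\<close> for some \<open>N > 0\<close>.

  If \<open>N\<close> rows are independent, then the vector \<open>(1, t, \<dots>, t\<^sup>N)\<close> spans their kernel, and Cramer's
  rule expresses \<open>t\<close> as a quotient of two minors. The entries of the rows are linear forms in the
  \<open>G\<^sub>i(t)\<close> with constant coefficients, so the minors are forms of degree \<open>N\<close> evaluated at \<open>G\<close> and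
  give the inverse (lemma \<open>koszul_minor_imp_inverse\<close>).

  Conversely, modulo the Koszul relations \<open>G\<^sub>z(t)\<^sup>e F(G(s)) \<equiv> G\<^sub>z(s)\<^sup>e F(G(t))\<close> for every form \<open>F\<close> of
  degree \<open>e\<close>. Without base points every \<open>f\<close> of large degree is a combination of the \<open>G\<^sub>i(s)\<close>, so
  likewise \<open>G\<^sub>z(t)\<^sup>e f \<equiv> G\<^sub>z(s)\<^sup>e A\<close> for some \<open>A\<close>. Write \<open>H\<^sub>i\<close> for \<open>h\<^sub>i(G)\<close>, so that
  \<open>H\<^sub>1 = t H\<^sub>0\<close>. Then
  \<open>G\<^sub>z(t)\<^sup>e H\<^sub>0(t) (t - s) f \<equiv> G\<^sub>z(s)\<^sup>e H\<^sub>0(t) (t - s) A \<equiv> G\<^sub>z(t)\<^sup>e (t H\<^sub>0(s) - H\<^sub>1(s)) A\<close>,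
  which is congruent to \<open>G\<^sub>z(s)\<^sup>e (t H\<^sub>0(t) - H\<^sub>1(t)) A = 0\<close>. Hence a nonzero multiple of every
  \<open>(t - s) s\<^sup>b\<close> with \<open>b < N\<close> lies in the span of the Koszul rows, and the rank is \<open>N\<close>
  (lemma \<open>inverse_imp_koszul_minor\<close>). The argument works over every field.
\<close>

section \<open>Substitution homomorphisms\<close>

lemma mdeg_superset:
  assumes "finite K" "Poly_Mapping.keys m \<subseteq> K"
  shows "mdeg m = (\<Sum>i\<in>K. Poly_Mapping.lookup m i)"
  unfolding mdeg_def by (rule sum.mono_neutral_left) (use assms in \<open>auto simp: in_keys_iff\<close>)

lemma mdeg_0 [simp]: "mdeg 0 = 0"
  by (simp add: mdeg_def)

lemma mdeg_single [simp]: "mdeg (Poly_Mapping.single i n) = n"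
  by (simp add: mdeg_def)

lemma mdeg_add: "mdeg (m + n) = mdeg m + mdeg n"
proof -
  let ?K = "Poly_Mapping.keys m \<union> Poly_Mapping.keys n"
  have "mdeg (m + n) = (\<Sum>i\<in>?K. Poly_Mapping.lookup (m + n) i)"
    by (rule mdeg_superset) (use Poly_Mapping.keys_add[of m n] in auto)
  then show ?thesis
    by (simp add: lookup_add sum.distrib mdeg_superset[of ?K m] mdeg_superset[of ?K n])
qed

lemma monomial_induct [case_names zero step]:
  assumes "P 0" and step: "\<And>i m. P m \<Longrightarrow> P (Poly_Mapping.single i 1 + m)"
  shows "P (m :: 'v \<Rightarrow>\<^sub>0 nat)"
proof (induction "mdeg m" arbitrary: m)
  case 0
  then have "\<forall>i\<in>Poly_Mapping.keys m. Poly_Mapping.lookup m i = 0"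
    by (simp add: mdeg_def)
  then have "Poly_Mapping.keys m = {}" by (metis in_keys_iff equals0I)
  then have "m = 0" by (rule keys_eq_empty[THEN iffD1])
  then show ?case using assms(1) by simp
next
  case (Suc n)
  then have "Poly_Mapping.keys m \<noteq> {}" by auto
  then obtain i where "i \<in> Poly_Mapping.keys m" by blast
  then have i: "Poly_Mapping.lookup m i > 0" by (simp add: in_keys_iff)
  define m' where "m' = m - Poly_Mapping.single i 1"
  have m: "m = Poly_Mapping.single i 1 + m'"
    by (rule poly_mapping_eqI) (use i in \<open>auto simp: m'_def lookup_add lookup_minus lookup_single when_def\<close>)
  then have "n = mdeg m'" using Suc.hyps(2) by (simp add: mdeg_add)
  then show ?case using Suc.hyps(1) step m by metis
qed

lemma mono_eval_0 [simp]: "mono_eval v 0 = 1"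
  by (simp add: mono_eval_def)

lemma mono_eval_single: "mono_eval v (Poly_Mapping.single i n) = v i ^ n"
  by (simp add: mono_eval_def)

lemma eval_hom_superset:
  assumes "h 0 = 0" "finite K" "Poly_Mapping.keys p \<subseteq> K"
  shows "eval_hom h v p = (\<Sum>m\<in>K. h (Poly_Mapping.lookup p m) * mono_eval v m)"
  unfolding eval_hom_def
  by (rule sum.mono_neutral_left) (use assms in \<open>auto simp: in_keys_iff\<close>)

lemma eval_hom_single:
  "h 0 = 0 \<Longrightarrow> eval_hom h v (Poly_Mapping.single m c) = h c * mono_eval v m"
  by (simp add: eval_hom_superset[of h "{m}"])

lemma comm_ring_hom_eval_hom:
  fixes h :: "'a::comm_ring_1 \<Rightarrow> 'b::comm_ring_1"
  assumes "comm_ring_hom h"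
  shows "comm_ring_hom (eval_hom h v)"
proof -
  interpret h: comm_ring_hom h by fact
  let ?e = "eval_hom h v" and ?l = Poly_Mapping.lookup and ?s = Poly_Mapping.single
  have add: "?e (p + q) = ?e p + ?e q" for p q
  proof -
    let ?K = "Poly_Mapping.keys p \<union> Poly_Mapping.keys q"
    have "?e (p + q) = (\<Sum>m\<in>?K. h (?l (p + q) m) * mono_eval v m)"
      by (rule eval_hom_superset) (use Poly_Mapping.keys_add[of p q] in auto)
    also have "\<dots> = ?e p + ?e q"
      by (simp add: lookup_add h.hom_add algebra_simps sum.distrib
          eval_hom_superset[of h ?K p] eval_hom_superset[of h ?K q])
    finally show ?thesis .
  qed
  have zero: "?e 0 = 0" by (simp add: eval_hom_def)
  have sum: "?e (sum f A) = (\<Sum>x\<in>A. ?e (f x))" for f :: "'x \<Rightarrow> _" and A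
    by (induction A rule: infinite_finite_induct) (simp_all add: add zero)
  have mult: "?e (p * q) = ?e p * ?e q" for p q
  proof -
    have "p * q = (\<Sum>m\<in>Poly_Mapping.keys p. \<Sum>n\<in>Poly_Mapping.keys q.
        ?s (m + n) (?l p m * ?l q n))"
      by (subst mpoly_expand[of p], subst mpoly_expand[of q])
        (simp add: sum_product mult_single)
    hence "?e (p * q) = (\<Sum>m\<in>Poly_Mapping.keys p. \<Sum>n\<in>Poly_Mapping.keys q.
        (h (?l p m) * mono_eval v m) * (h (?l q n) * mono_eval v n))"
      by (simp add: sum eval_hom_single mono_eval_add h.hom_mult mult_ac)
    also have "\<dots> = ?e p * ?e q"
      by (simp add: eval_hom_def sum_product)
    finally show ?thesis .
  qed
  show ?thesis
    by unfold_locales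
      (simp_all add: add mult zero eval_hom_single flip: single_one)
qed

lemma comm_ring_hom_Const: "comm_ring_hom (Const :: 'a::comm_ring_1 \<Rightarrow> ('v, 'a) mpoly)"
  by unfold_locales (simp_all add: Const_def single_add mult_single single_one)

lemma comm_ring_hom_const_poly: "comm_ring_hom (\<lambda>c::'a::comm_ring_1. [:c:])"
  by unfold_locales (simp_all add: one_pCons)

lemma comm_ring_hom_comp:
  assumes "comm_ring_hom f" "comm_ring_hom g"
  shows "comm_ring_hom (\<lambda>x. f (g x))"
proof -
  interpret f: comm_ring_hom f by fact
  interpret g: comm_ring_hom g by fact
  show ?thesis
    by unfold_locales (simp_all add: f.hom_add g.hom_add f.hom_mult g.hom_mult)
qed

lemma subst_hom: "comm_ring_hom (subst f :: ('v, 'a::comm_ring_1) mpoly \<Rightarrow> ('w, 'a) mpoly)"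
  unfolding subst_def by (rule comm_ring_hom_eval_hom[OF comm_ring_hom_Const])

lemma hom_mono_eval:
  assumes "comm_ring_hom \<phi>" shows "\<phi> (mono_eval v m) = mono_eval (\<lambda>i. \<phi> (v i)) m"
proof -
  interpret comm_ring_hom \<phi> by fact
  show ?thesis by (simp add: mono_eval_def hom_prod hom_power)
qed

lemma hom_eval_hom:
  assumes "comm_ring_hom \<phi>"
  shows "\<phi> (eval_hom h v p) = eval_hom (\<lambda>c. \<phi> (h c)) (\<lambda>i. \<phi> (v i)) p"
proof -
  interpret comm_ring_hom \<phi> by fact
  show ?thesis by (simp add: eval_hom_def hom_sum hom_mult hom_mono_eval[OF assms])
qed

lemma eval_hom_Const [simp]: "h 0 = 0 \<Longrightarrow> eval_hom h v (Const c) = h c"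
  by (simp add: Const_def eval_hom_single)

lemma eval_hom_Var [simp]: "h 0 = 0 \<Longrightarrow> h 1 = 1 \<Longrightarrow> eval_hom h v (Var i) = v i"
  by (simp add: Var_def eval_hom_single mono_eval_single)

lemma Const_0 [simp]: "Const 0 = 0"
  by (simp add: Const_def)

lemma Const_1 [simp]: "Const 1 = (1 :: ('v, 'a::comm_ring_1) mpoly)"
  by (simp add: Const_def single_one)

lemma mono_eval_Var: "mono_eval Var m = Poly_Mapping.single m (1::'a::comm_ring_1)"
  by (induction m rule: monomial_induct)
    (simp_all add: mono_eval_add mono_eval_single mult_single Var_def)

lemma subst_Var: "subst Var p = (p :: ('v, 'a::comm_ring_1) mpoly)"
proof -
  have "subst Var p = (\<Sum>m\<in>Poly_Mapping.keys p. Poly_Mapping.single m (Poly_Mapping.lookup p m))"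
    by (simp add: subst_def eval_hom_def mono_eval_Var Const_def mult_single)
  also have "\<dots> = p" by (rule mpoly_expand[symmetric])
  finally show ?thesis .
qed

section \<open>Forms and homogeneous components\<close>

lemma is_form_0 [simp]: "is_form e 0"
  by (simp add: is_form_def)

lemma is_form_single: "is_form (mdeg m) (Poly_Mapping.single m c)"
  by (simp add: is_form_def)

lemma is_form_Const [simp]: "is_form 0 (Const c)"
  by (simp add: is_form_def Const_def)

lemma is_form_1 [simp]: "is_form 0 (1 :: ('v, 'a::comm_ring_1) mpoly)"
  using is_form_Const[of "1::'a"] by simp

lemma is_form_Var [simp]: "is_form 1 (Var i)"
  by (simp add: is_form_def Var_def)

lemma is_form_add: "is_form e p \<Longrightarrow> is_form e q \<Longrightarrow> is_form e (p + q)"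
  using Poly_Mapping.keys_add[of p q] by (auto simp: is_form_def)

lemma is_form_uminus: "is_form e p \<Longrightarrow> is_form e (- p :: ('v, 'a::comm_ring_1) mpoly)"
  by (auto simp: is_form_def in_keys_iff)

lemma is_form_diff:
  "is_form e p \<Longrightarrow> is_form e q \<Longrightarrow> is_form e (p - q :: ('v, 'a::comm_ring_1) mpoly)"
  using is_form_add[of e p "- q"] is_form_uminus by fastforce

lemma is_form_sum: "(\<And>x. x \<in> A \<Longrightarrow> is_form e (f x)) \<Longrightarrow> is_form e (sum f A)"
  by (induction A rule: infinite_finite_induct) (simp_all add: is_form_add)

lemma is_form_mult:
  "is_form e p \<Longrightarrow> is_form f q \<Longrightarrow> is_form (e + f) (p * q :: ('v, 'a::comm_ring_1) mpoly)"
  using Poly_Mapping.keys_mult[of p q] by (fastforce simp: is_form_def mdeg_add)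

lemma is_form_Const_mult: "is_form e p \<Longrightarrow> is_form e (Const c * p :: ('v, 'a::comm_ring_1) mpoly)"
  using is_form_mult[OF is_form_Const] by fastforce

lemma is_form_power: "is_form e p \<Longrightarrow> is_form (n * e) (p ^ n :: ('v, 'a::comm_ring_1) mpoly)"
  by (induction n) (simp_all add: is_form_mult)

lemma is_form_prod:
  fixes f :: "'x \<Rightarrow> ('v, 'a::comm_ring_1) mpoly"
  shows "(\<And>x. x \<in> A \<Longrightarrow> is_form (e x) (f x)) \<Longrightarrow> is_form (sum e A) (prod f A)"
  by (induction A rule: infinite_finite_induct) (simp_all add: is_form_mult)

lemma is_form_mono_eval:
  fixes v :: "'u \<Rightarrow> ('v, 'a::comm_ring_1) mpoly"
  assumes "\<And>i. is_form d (v i)"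
  shows "is_form (mdeg m * d) (mono_eval v m)"
  unfolding mono_eval_def mdeg_def sum_distrib_right
  by (intro is_form_prod is_form_power assms)

lemma is_form_subst:
  fixes v :: "'u \<Rightarrow> ('v, 'a::comm_ring_1) mpoly"
  assumes "\<And>i. is_form d (v i)" "is_form e p"
  shows "is_form (e * d) (subst v p)"
  unfolding subst_def eval_hom_def
proof (intro is_form_sum is_form_Const_mult)
  fix m assume "m \<in> Poly_Mapping.keys p"
  then show "is_form (e * d) (mono_eval v m)"
    using is_form_mono_eval[OF assms(1), of m] assms(2) by (simp add: is_form_def)
qed

definition component :: "nat \<Rightarrow> ('v, 'a::comm_ring_1) mpoly \<Rightarrow> ('v, 'a) mpoly" where
  "component e p = (\<Sum>m | m \<in> Poly_Mapping.keys p \<and> mdeg m = e.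
     Poly_Mapping.single m (Poly_Mapping.lookup p m))"

lemma lookup_component:
  "Poly_Mapping.lookup (component e p) m = (if mdeg m = e then Poly_Mapping.lookup p m else 0)"
proof -
  have "Poly_Mapping.lookup (component e p) m =
    (\<Sum>n | n \<in> Poly_Mapping.keys p \<and> mdeg n = e. if n = m then Poly_Mapping.lookup p n else 0)"
    by (simp add: component_def lookup_sum lookup_single when_def)
  also have "\<dots> = (if mdeg m = e then Poly_Mapping.lookup p m else 0)"
    by (subst sum.delta) (auto simp: in_keys_iff)
  finally show ?thesis .
qed

lemma is_form_component: "is_form e (component e p)"
  by (auto simp: is_form_def in_keys_iff lookup_component split: if_splits)

lemma component_form: "is_form f p \<Longrightarrow> component e p = (if e = f then p else 0)"
  by (rule poly_mapping_eqI) (auto simp: lookup_component is_form_def in_keys_iff)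

lemma component_0 [simp]: "component e 0 = 0"
  by (simp add: component_def)

lemma component_add: "component e (p + q) = component e p + component e q"
  by (rule poly_mapping_eqI) (auto simp: lookup_component lookup_add)

lemma component_sum: "component e (sum f A) = (\<Sum>x\<in>A. component e (f x))"
  by (induction A rule: infinite_finite_induct) (simp_all add: component_add)

lemma sum_components: "(p :: ('v, 'a::comm_ring_1) mpoly) = (\<Sum>e\<in>mdeg ` Poly_Mapping.keys p. component e p)"
  by (rule poly_mapping_eqI) (auto simp: lookup_component lookup_sum sum.delta in_keys_iff)

text \<open>Distinct degrees cannot interfere, so each summand can be read off from the sum.\<close>

lemma sum_component_sum:
  assumes "inj_on e A" "finite A" "\<And>x. x \<in> A \<Longrightarrow> is_form (e x) (f x)" "y \<in> A"
  shows "component (e y) (sum f A) = f y"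
proof -
  have "component (e y) (f x) = (if x = y then f y else 0)" if "x \<in> A" for x
    using component_form[OF assms(3)[OF that]] inj_onD[OF assms(1) _ that assms(4)] by auto
  then have "component (e y) (sum f A) = (\<Sum>x\<in>A. if x = y then f y else 0)"
    by (simp add: component_sum)
  then show ?thesis using assms by simp
qed

text \<open>Forms respect proportionality: with \<open>a = \<lambda>b\<close> and \<open>\<lambda> = t / s\<close>, this is
  \<open>F(a) = \<lambda>\<^sup>e F(b)\<close> without denominators.\<close>

lemma eval_hom_proportional:
  fixes h :: "'a::comm_ring_1 \<Rightarrow> 'b::comm_ring_1"
  assumes "\<And>i. a i * s = b i * t" "is_form e F"
  shows "eval_hom h a F * s ^ e = eval_hom h b F * t ^ e"
proof -
  have mono: "mono_eval a m * s ^ mdeg m = mono_eval b m * t ^ mdeg m" for m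
  proof (induction m rule: monomial_induct)
    case (step i m)
    have "mono_eval a (Poly_Mapping.single i 1 + m) * s ^ mdeg (Poly_Mapping.single i 1 + m)
      = (a i * s) * (mono_eval a m * s ^ mdeg m)"
      by (simp add: mono_eval_add mono_eval_single mdeg_add mult_ac)
    also have "\<dots> = (b i * t) * (mono_eval b m * t ^ mdeg m)"
      by (simp only: assms(1) step)
    also have "\<dots> = mono_eval b (Poly_Mapping.single i 1 + m) * t ^ mdeg (Poly_Mapping.single i 1 + m)"
      by (simp add: mono_eval_add mono_eval_single mdeg_add mult_ac)
    finally show ?case .
  qed simp
  show ?thesis
    unfolding eval_hom_def sum_distrib_right
    by (rule sum.cong) (use assms(2) mono in \<open>auto simp: is_form_def mult.assoc\<close>)
qed

section \<open>Homogeneous prime ideals\<close>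

lemma ideal_type_iff:
  "ideal P (ring_of_type_algebra :: 'r::comm_ring_1 ring) \<longleftrightarrow>
     0 \<in> P \<and> (\<forall>x\<in>P. \<forall>y\<in>P. x + y \<in> P) \<and> (\<forall>r. \<forall>x\<in>P. r * x \<in> P)" (is "_ \<longleftrightarrow> ?rhs")
proof
  assume "ideal P (ring_of_type_algebra :: 'r ring)"
  then interpret ideal P "ring_of_type_algebra :: 'r ring" .
  have "0 \<in> P" using additive_subgroup.zero_closed[OF is_additive_subgroup] by (simp add: ring_of_type_algebra_def)
  moreover have "x + y \<in> P" if "x \<in> P" "y \<in> P" for x y
    using additive_subgroup.a_closed[OF is_additive_subgroup that] by (simp add: ring_of_type_algebra_def)
  moreover have "r * x \<in> P" if "x \<in> P" for r x
    using I_l_closed[OF that, of r] by (simp add: ring_of_type_algebra_def)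
  ultimately show ?rhs by blast
next
  assume R: ?rhs
  have uminus: "- x \<in> P" if "x \<in> P" for x
    using R that by (metis mult_minus1)
  have inv: "\<exists>y\<in>P. x + y = 0" if "x \<in> P" for x
    using uminus[OF that] by (intro bexI[of _ "- x"]) auto
  have ring: "ring (ring_of_type_algebra :: 'r ring)" by (rule ring_from_type_algebra)
  interpret ring "ring_of_type_algebra :: 'r ring" by (rule ring)
  have minv: "inv\<^bsub>add_monoid ring_of_type_algebra\<^esub> x = - x" for x :: 'r
  proof -
    have "\<ominus>\<^bsub>ring_of_type_algebra\<^esub> x = - x"
      by (rule minus_equality) (simp_all add: ring_of_type_algebra_def)
    then show ?thesis by (simp only: a_inv_def)
  qed
  show "ideal P (ring_of_type_algebra :: 'r ring)"
  proof (rule idealI[OF ring])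
    show "subgroup P (add_monoid (ring_of_type_algebra :: 'r ring))"
      using R uminus minv by unfold_locales (auto simp: ring_of_type_algebra_def)
    fix a x assume "a \<in> P" "x \<in> carrier (ring_of_type_algebra :: 'r ring)"
    then show "x \<otimes>\<^bsub>ring_of_type_algebra\<^esub> a \<in> P" "a \<otimes>\<^bsub>ring_of_type_algebra\<^esub> x \<in> P"
      using R by (simp_all add: ring_of_type_algebra_def mult.commute[of a x])
  qed
qed

lemma primeideal_type_iff:
  "primeideal P (ring_of_type_algebra :: 'r::comm_ring_1 ring) \<longleftrightarrow>
     ideal P (ring_of_type_algebra :: 'r ring) \<and> 1 \<notin> P \<and> (\<forall>a b. a * b \<in> P \<longrightarrow> a \<in> P \<or> b \<in> P)"
  (is "_ \<longleftrightarrow> ?rhs")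
proof
  assume "primeideal P (ring_of_type_algebra :: 'r ring)"
  then interpret primeideal P "ring_of_type_algebra :: 'r ring" .
  have "1 \<notin> P"
  proof
    assume "1 \<in> P"
    then have "x \<in> P" for x using I_l_closed[of 1 x] by (simp add: ring_of_type_algebra_def)
    with I_notcarr show False by (auto simp: ring_of_type_algebra_def)
  qed
  then show ?rhs using I_prime is_ideal by (auto simp: ring_of_type_algebra_def)
next
  assume R: ?rhs
  show "primeideal P (ring_of_type_algebra :: 'r ring)"
    by (rule primeidealI) (use R cring_from_type_algebra in \<open>auto simp: ring_of_type_algebra_def\<close>)
qed

lemma primeideal_vimage:
  assumes "comm_ring_hom \<phi>" "primeideal Q ring_of_type_algebra"
  shows "primeideal (\<phi> -` Q) ring_of_type_algebra"
proof -
  interpret comm_ring_hom \<phi> by fact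
  show ?thesis
    using assms(2) by (auto simp: primeideal_type_iff ideal_type_iff hom_add hom_mult)
qed

lemma primeideal_0: "primeideal {0} (ring_of_type_algebra :: 'r::idom ring)"
  by (auto simp: primeideal_type_iff ideal_type_iff)

lemma ideal_sum:
  assumes "ideal P (ring_of_type_algebra :: 'r::comm_ring_1 ring)" "\<And>x. x \<in> A \<Longrightarrow> f x \<in> P"
  shows "sum f A \<in> P"
  using assms(2)
  by (induction A rule: infinite_finite_induct) (use assms(1) in \<open>auto simp: ideal_type_iff\<close>)

lemma primeideal_power:
  "primeideal P (ring_of_type_algebra :: 'r::comm_ring_1 ring) \<Longrightarrow> x ^ n \<in> P \<Longrightarrow> x \<in> P"
  by (induction n) (auto simp: primeideal_type_iff)

lemma genideal_subset_iff:
  "ideal P R \<Longrightarrow> genideal R S \<subseteq> P \<longleftrightarrow> S \<subseteq> P"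
  unfolding genideal_def by blast

text \<open>The polynomials all of whose components lie in \<open>P\<close> form an ideal: a product with a
  monomial shifts the components. This ideal contains the forms in \<open>P\<close>, hence also the ideal
  that they generate.\<close>

lemma homogeneous_ideal_iff:
  fixes P :: "('v, 'a::field) mpoly set"
  assumes P: "ideal P ring_of_type_algebra"
  shows "homogeneous_ideal P \<longleftrightarrow> (\<forall>F\<in>P. \<forall>e. component e F \<in> P)"
proof -
  let ?S = "{p \<in> P. \<exists>e. is_form e p}" and ?Q = "{F. \<forall>e. component e F \<in> P}"
  note I = P[unfolded ideal_type_iff]
  have mult: "q * F \<in> ?Q" if F: "F \<in> ?Q" for q F
  proof -
    have summand: "component e (Poly_Mapping.single m c * component f F) \<in> P" for e m c f
    proof -
      have "is_form (mdeg m + f) (Poly_Mapping.single m c * component f F)"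
        by (intro is_form_mult is_form_single is_form_component)
      moreover have "Poly_Mapping.single m c * component f F \<in> P"
        using F I by auto
      ultimately show ?thesis using I by (simp add: component_form)
    qed
    have "q * F = (\<Sum>m\<in>Poly_Mapping.keys q. \<Sum>f\<in>mdeg ` Poly_Mapping.keys F.
        Poly_Mapping.single m (Poly_Mapping.lookup q m) * component f F)"
      by (subst mpoly_expand[of q], subst sum_components[of F]) (simp add: sum_product)
    then show ?thesis
      by (auto simp: component_sum intro!: ideal_sum[OF P] summand)
  qed
  have Q: "ideal ?Q ring_of_type_algebra"
    unfolding ideal_type_iff using I mult by (auto simp: component_add)
  have "?S \<subseteq> ?Q" using I by (auto simp: component_form)
  then have sub: "genideal ring_of_type_algebra ?S \<subseteq> ?Q"
    using genideal_subset_iff[OF Q] by blast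
  have subP: "genideal ring_of_type_algebra ?S \<subseteq> P"
    using genideal_subset_iff[OF P] by blast
  show ?thesis
  proof
    assume "homogeneous_ideal P"
    then show "\<forall>F\<in>P. \<forall>e. component e F \<in> P"
      using sub unfolding homogeneous_ideal_def by blast
  next
    assume c: "\<forall>F\<in>P. \<forall>e. component e F \<in> P"
    have "F \<in> genideal ring_of_type_algebra ?S" if "F \<in> P" for F
      unfolding genideal_def
    proof safe
      fix J assume J: "ideal J ring_of_type_algebra" "?S \<subseteq> J"
      have "component e F \<in> J" for e
        using J(2) c that is_form_component by blast
      then show "F \<in> J"
        by (subst sum_components) (intro ideal_sum[OF J(1)])
    qed
    with subP show "homogeneous_ideal P" unfolding homogeneous_ideal_def by blast
  qed
qed

lemma Proj_iff:
  "P \<in> Proj \<longleftrightarrow> primeideal P ring_of_type_algebra \<and> (\<forall>F\<in>P. \<forall>e. component e F \<in> P) \<and>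
     (\<exists>i. Var i \<notin> P)"
  unfolding Proj_def using homogeneous_ideal_iff primeideal_type_iff by blast

lemma Var_neq_0 [simp]: "Var i \<noteq> (0 :: ('v, 'a::zero_neq_one) mpoly)"
  by (metis Var_def lookup_single_eq lookup_zero zero_neq_one)

lemma zero_in_Proj: "{0} \<in> (Proj :: ('v::{finite,linorder}, 'a::field) mpoly set set)"
  by (simp add: Proj_iff primeideal_0)

lemma zero_in_point: "P \<in> Proj \<Longrightarrow> 0 \<in> P"
  by (simp add: Proj_iff primeideal_type_iff ideal_type_iff)

lemma vanishing_ideal_Proj:
  "vanishing_ideal Proj = ({0} :: ('v::{finite,linorder}, 'a::field) mpoly set)"
  unfolding vanishing_ideal_def using zero_in_Proj zero_in_point by blast

section \<open>The inverse of a birational parametrization\<close>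

text \<open>Substituting forms of degree \<open>d\<close> multiplies degrees by \<open>d\<close>; positivity of \<open>d\<close> keeps distinct
  degrees apart. Thus contractions along such substitutions preserve homogeneity.\<close>

lemma component_subst:
  fixes f :: "'u \<Rightarrow> ('v, 'a::comm_ring_1) mpoly"
  assumes "\<And>i. is_form d (f i)" "d > 0"
  shows "component (e * d) (subst f F) = subst f (component e F)"
proof -
  interpret comm_ring_hom "subst f" by (rule subst_hom)
  let ?E = "insert e (mdeg ` Poly_Mapping.keys F)"
  have "F = (\<Sum>e\<in>?E. component e F)"
    by (rule poly_mapping_eqI) (auto simp: lookup_component lookup_sum sum.delta in_keys_iff)
  then have "subst f F = (\<Sum>e\<in>?E. subst f (component e F))" by (metis hom_sum)
  moreover have "component (e * d) (\<Sum>e\<in>?E. subst f (component e F)) = subst f (component e F)"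
    using assms
    by (intro sum_component_sum[where e = "\<lambda>e. e * d"])
      (auto simp: inj_on_def intro!: is_form_subst is_form_component)
  ultimately show ?thesis by simp
qed

lemma subst_Var_left: "subst f (Var i) = (f i :: ('w, 'a::comm_ring_1) mpoly)"
  by (simp add: subst_def)

lemma ideal_of_subset_iff: "ideal q ring_of_type_algebra \<Longrightarrow> ideal_of g \<subseteq> q \<longleftrightarrow> (\<forall>i. g i \<in> q)"
  unfolding ideal_of_def by (subst genideal_subset_iff) auto

lemma base_points_iff: "q \<in> base_points g \<longleftrightarrow> q \<in> Proj \<and> (\<forall>i. g i \<in> q)"
  unfolding base_points_def Proj_zeros_def
  using ideal_of_subset_iff by (auto simp: Proj_iff primeideal_type_iff)

lemma Psi_in_Proj:
  assumes "g \<in> triples d" "d > 0" "q \<in> Proj" "q \<notin> base_points g"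
  shows "Psi g q \<in> Proj"
proof -
  have g: "is_form d (g i)" for i using assms(1) by (simp add: triples_def)
  show ?thesis
    unfolding Proj_iff Psi_def
  proof (intro conjI ballI allI)
    show "primeideal (subst g -` q) ring_of_type_algebra"
      using assms(3) by (intro primeideal_vimage subst_hom) (simp add: Proj_iff)
    show "component e F \<in> subst g -` q" if "F \<in> subst g -` q" for F e
      using that assms(3) component_subst[where f = g and e = e and F = F, OF g assms(2)] by (simp add: Proj_iff) metis
    show "\<exists>i. Var i \<notin> subst g -` q"
      using assms(3,4) by (simp add: subst_Var_left base_points_iff)
  qed
qed

text \<open>The generic point \<open>{0}\<close> of the projective line maps to the kernel of the substitution, which is
  contained in every other point of the image. The closure of the image is therefore the closure
  of this one point.\<close>

lemma vanishing_ideal_image_closure: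
  assumes "g \<in> triples d" "d > 0" "\<exists>i. g i \<noteq> 0"
  shows "vanishing_ideal (image_closure g) = subst g -` {0}"
proof -
  let ?Z = "Psi g ` (Proj - base_points g)" and ?K = "Psi g {0}"
  have Z: "?Z \<subseteq> Proj" using Psi_in_Proj[OF assms(1,2)] by blast
  have K: "?K \<in> ?Z" using assms(3) zero_in_Proj by (auto simp: base_points_iff)
  have low: "?K \<subseteq> P" if "P \<in> ?Z" for P
    using that zero_in_point by (auto simp: Psi_def)
  have "Proj_closure ?Z = {P \<in> Proj. ?K \<subseteq> P}"
  proof (intro equalityI subsetI)
    fix P assume "P \<in> Proj_closure ?Z"
    moreover have "?Z \<subseteq> Proj_zeros ?K" using Z low by (auto simp: Proj_zeros_def)
    ultimately show "P \<in> {P \<in> Proj. ?K \<subseteq> P}" by (auto simp: Proj_closure_def Proj_zeros_def)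
  next
    fix P assume P: "P \<in> {P \<in> Proj. ?K \<subseteq> P}"
    show "P \<in> Proj_closure ?Z"
      unfolding Proj_closure_def
    proof (intro InterI)
      fix W assume "W \<in> {Proj_zeros S | S. ?Z \<subseteq> Proj_zeros S}"
      then obtain S where S: "W = Proj_zeros S" "?Z \<subseteq> Proj_zeros S" by blast
      then have "S \<subseteq> ?K" using K unfolding Proj_zeros_def by blast
      with P S show "P \<in> W" by (auto simp: Proj_zeros_def)
    qed
  qed
  moreover have "?K \<in> Proj" using K Z by blast
  ultimately have "\<Inter>(Proj_closure ?Z) = ?K" by blast
  then show ?thesis by (simp add: vanishing_ideal_def image_closure_def Psi_def)
qed

lemma subst_subst: "subst f (subst h F) = subst (\<lambda>i. subst f (h i)) (F :: ('v, 'a::comm_ring_1) mpoly)"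
proof -
  interpret comm_ring_hom "subst f" by (rule subst_hom)
  have "subst f (Const c) = Const c" for c by (simp add: subst_def)
  then show ?thesis
    using hom_eval_hom[OF subst_hom, of f Const h F] by (simp add: subst_def)
qed

text \<open>One composite of \<open>g\<close> with a candidate inverse \<open>h\<close> is the pair \<open>h\<^sub>i(g)\<close>, which must be
  proportional to the variables. This alone suffices: substituting a pair proportional
  to the variables into a form only rescales the form, so the other composite is proportional to
  the identity along the curve.\<close>

lemma birational_onto_image_iff:
  assumes g: "g \<in> triples d" and "d > 0" and nz: "\<exists>i. g i \<noteq> 0"
  shows "birational_onto_image g \<longleftrightarrow>
    (\<exists>h e. (\<forall>i. is_form e (h i)) \<and> (\<exists>i. subst g (h i) \<noteq> 0) \<and>
       (\<forall>i j. subst g (h i) * Var j = subst g (h j) * Var i))" (is "_ \<longleftrightarrow> (\<exists>h e. ?P h e)")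
proof -
  have gf: "is_form d (g i)" for i using g by (simp add: triples_def)
  have J: "vanishing_ideal (Proj :: (2, 'a) mpoly set set) = {0}" by (rule vanishing_ideal_Proj)
  note J' = vanishing_ideal_image_closure[OF assms]
  interpret sg: comm_ring_hom "subst g" by (rule subst_hom)
  have s0: "subst f 0 = 0" for f :: "'x \<Rightarrow> ('y, 'a) mpoly" by (simp add: subst_def eval_hom_def)
  have gr: "rational_map {0} (subst g -` {0}) g"
    using gf nz by (auto simp: rational_map_def)
  show ?thesis
  proof
    assume "birational_onto_image g"
    then obtain h where h: "rational_map (subst g -` {0}) {0} h"
      and "same_rational_map {0} (comp_map g h) Var"
      unfolding birational_onto_image_def birational_map_def J J' by blast
    then have "\<forall>i j. subst g (h i) * Var j = subst g (h j) * Var i"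
      by (simp add: same_rational_map_def comp_map_def)
    with h show "\<exists>h e. ?P h e" by (auto simp: rational_map_def)
  next
    assume "\<exists>h e. ?P h e"
    then obtain h e z where he: "\<And>i. is_form e (h i)" and z: "subst g (h z) \<noteq> 0"
      and ratio: "\<And>i j. subst g (h i) * Var j = subst g (h j) * Var i" by blast
    define k where "k i = subst g (h i)" for i
    \<comment> \<open>The inverse makes the composite proportional to the identity, so substituting the
      composite into a form multiplies it by a power of the proportionality factor.\<close>
    have kF: "subst k F * Var z ^ n = F * k z ^ n" if "is_form n F" for F n
      using eval_hom_proportional[of k "Var z" Var "k z" n F Const] that ratio subst_Var[of F]
      by (simp add: k_def subst_def mult.commute)
    have gg: "subst g (subst h (g i)) * Var z ^ d = g i * k z ^ d" for i
      using kF[OF gf, of i] unfolding subst_subst k_def .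
    have Vz: "(Var z :: (2, 'a) mpoly) ^ n \<noteq> 0" for n by simp
    have 1: "rational_map (subst g -` {0}) {0} h"
      using he z by (auto simp: rational_map_def s0)
    have 2: "rational_map {0} {0} (comp_map g h)"
      using is_form_subst[where v = g, OF gf he] z by (auto simp: rational_map_def comp_map_def s0)
    have 3: "same_rational_map {0} (comp_map g h) Var"
      using ratio by (simp add: same_rational_map_def comp_map_def)
    have 4: "rational_map (subst g -` {0}) (subst g -` {0}) (comp_map h g)"
      unfolding rational_map_def comp_map_def
    proof (intro conjI ballI)
      show "\<exists>e. \<forall>i. is_form e (subst h (g i))"
        using is_form_subst[where v = h, OF he gf] by blast
      obtain i where "g i \<noteq> 0" using nz by blast
      then have "subst g (subst h (g i)) * Var z ^ d \<noteq> 0"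
        using z by (simp add: gg k_def)
      then show "\<exists>i. subst h (g i) \<notin> subst g -` {0}" by auto
      fix F assume "F \<in> subst g -` {0}"
      then have F0: "subst g (component n F) = 0" for n
        using component_subst[where f = g and e = n and F = F, OF gf \<open>d > 0\<close>] by simp
      have power_eq: "subst (\<lambda>i. subst g (subst h (g i))) (component n F) * (Var z ^ d) ^ n
         = subst g (component n F) * (k z ^ d) ^ n" for n
        unfolding subst_def
        by (rule eval_hom_proportional) (simp_all add: gg[unfolded subst_def] is_form_component)
      then have c0: "subst (\<lambda>i. subst g (subst h (g i))) (component n F) = 0" for n
      proof -
        have "subst (\<lambda>i. subst g (subst h (g i))) (component n F) * (Var z ^ d) ^ n = 0"
          by (simp only: power_eq F0 mult_zero_left)
        then show ?thesis by simp
      qed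
      interpret s: comm_ring_hom "subst (\<lambda>i. subst g (subst h (g i)))" by (rule subst_hom)
      have "subst (\<lambda>i. subst g (subst h (g i))) F = 0"
        by (subst sum_components) (simp add: s.hom_sum c0)
      then show "subst (\<lambda>i. subst h (g i)) F \<in> subst g -` {0}"
        by (simp add: subst_subst)
    qed
    have 5: "same_rational_map (subst g -` {0}) (comp_map h g) Var"
      unfolding same_rational_map_def
    proof (intro allI)
      fix i j
      have "(subst g (subst h (g i)) * g j - subst g (subst h (g j)) * g i) * Var z ^ d
        = (subst g (subst h (g i)) * Var z ^ d) * g j - (subst g (subst h (g j)) * Var z ^ d) * g i"
        by (simp add: algebra_simps)
      also have "\<dots> = 0" by (simp only: gg) (simp add: algebra_simps)
      finally have "subst g (subst h (g i)) * g j - subst g (subst h (g j)) * g i = 0"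
        using Vz by (simp only: mult_eq_0_iff) blast
      then show "comp_map h g i * Var j - comp_map h g j * Var i \<in> subst g -` {0}"
        by (simp add: comp_map_def sg.hom_minus sg.hom_mult subst_Var_left)
    qed
    show "birational_onto_image g"
      unfolding birational_onto_image_def birational_map_def J J'
      using gr 1 2 3 4 5 by blast
  qed
qed

section \<open>Dehomogenization of binary forms\<close>

lemma two_cases: "(i::2) = z \<or> i = z + 1"
proof -
  have "(UNIV :: 2 set) = {z, z + 1}"
  proof (rule card_subset_eq[symmetric])
    have "z \<noteq> z + 1" by simp
    then show "card {z, z + 1} = card (UNIV :: 2 set)" by simp
  qed simp_all
  then show ?thesis by blast
qed

lemma UNIV_two: "(UNIV :: 2 set) = {z, z + 1}"
  using two_cases by blast

text \<open>The two variables are indexed by \<open>z\<close> and \<open>z + 1\<close>, the addition being modulo 2. Treating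
  both choices of \<open>z\<close> alike covers both affine charts of the projective line.\<close>

definition mono2 :: "2 \<Rightarrow> nat \<Rightarrow> nat \<Rightarrow> (2 \<Rightarrow>\<^sub>0 nat)" where
  "mono2 z n l = Poly_Mapping.single z (n - l) + Poly_Mapping.single (z + 1) l"

lemma mdeg_two: "mdeg (m :: 2 \<Rightarrow>\<^sub>0 nat) = Poly_Mapping.lookup m z + Poly_Mapping.lookup m (z + 1)"
proof -
  have "mdeg m = (\<Sum>i\<in>{z, z + 1}. Poly_Mapping.lookup m i)"
    by (rule mdeg_superset) (use two_cases[of _ z] in auto)
  then show ?thesis by simp
qed

lemma lookup_mono2:
  "Poly_Mapping.lookup (mono2 z n l) z = n - l" "Poly_Mapping.lookup (mono2 z n l) (z + 1) = l"
  by (simp_all add: mono2_def lookup_add lookup_single)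

lemma mdeg_mono2: "l \<le> n \<Longrightarrow> mdeg (mono2 z n l) = n"
  by (simp add: mdeg_two[of _ z] lookup_mono2)

lemma eq_mono2: "mdeg m = n \<Longrightarrow> m = mono2 z n (Poly_Mapping.lookup m (z + 1))"
proof (rule poly_mapping_eqI)
  fix i assume "mdeg m = n"
  then show "Poly_Mapping.lookup m i = Poly_Mapping.lookup (mono2 z n (Poly_Mapping.lookup m (z + 1))) i"
    using two_cases[of i z] by (auto simp: lookup_mono2 mdeg_two[of m z])
qed

definition dehom :: "2 \<Rightarrow> (2, 'a::comm_ring_1) mpoly \<Rightarrow> 'a poly" where
  "dehom z = eval_hom (\<lambda>c. [:c:]) (\<lambda>i. if i = z then 1 else [:0, 1:])"

lemma dehom_hom: "comm_ring_hom (dehom z)"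
  unfolding dehom_def by (intro comm_ring_hom_eval_hom comm_ring_hom_const_poly)

lemma dehom_single: "dehom z (Poly_Mapping.single m c) = monom c (Poly_Mapping.lookup m (z + 1))"
proof -
  have "mono_eval (\<lambda>i. if i = z then 1 else [:0, 1:]) m = [:0, 1::'a:] ^ Poly_Mapping.lookup m (z + 1)"
    by (subst mono_eval_superset[of "{z, z + 1}"]) (simp_all flip: UNIV_two[of z], simp add: UNIV_two[of z])
  then show ?thesis by (simp add: dehom_def eval_hom_single monom_altdef)
qed

lemma coeff_dehom:
  assumes "is_form n F"
  shows "coeff (dehom z F) l = (if l \<le> n then Poly_Mapping.lookup F (mono2 z n l) else 0)"
proof -
  interpret comm_ring_hom "dehom z :: (2, 'a) mpoly \<Rightarrow> _" by (rule dehom_hom)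
  have "dehom z F = (\<Sum>m\<in>Poly_Mapping.keys F. monom (Poly_Mapping.lookup F m) (Poly_Mapping.lookup m (z + 1)))"
    by (subst mpoly_expand) (simp only: hom_sum dehom_single)
  then have "coeff (dehom z F) l =
      (\<Sum>m\<in>Poly_Mapping.keys F. if Poly_Mapping.lookup m (z + 1) = l then Poly_Mapping.lookup F m else 0)"
    by (simp add: coeff_sum)
  also have "\<dots> = (\<Sum>m\<in>Poly_Mapping.keys F. if m = mono2 z n l \<and> l \<le> n then Poly_Mapping.lookup F m else 0)"
  proof (rule sum.cong)
    fix m assume "m \<in> Poly_Mapping.keys F"
    then have "mdeg m = n" using assms by (simp add: is_form_def)
    then have "Poly_Mapping.lookup m (z + 1) = l \<longleftrightarrow> m = mono2 z n l \<and> l \<le> n"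
      using eq_mono2[of m n z] lookup_mono2(2)[of z n l] by (auto simp: mdeg_two[of m z])
    then show "(if Poly_Mapping.lookup m (z + 1) = l then Poly_Mapping.lookup F m else 0) =
      (if m = mono2 z n l \<and> l \<le> n then Poly_Mapping.lookup F m else 0)" by simp
  qed simp
  also have "\<dots> = (if l \<le> n then Poly_Mapping.lookup F (mono2 z n l) else 0)"
    by (cases "l \<le> n") (simp_all add: sum.delta in_keys_iff)
  finally show ?thesis .
qed

lemma degree_dehom: "is_form n F \<Longrightarrow> degree (dehom z F) \<le> n"
  by (rule degree_le) (simp add: coeff_dehom)

lemma dehom_inject:
  assumes "is_form n F" "is_form n G" "dehom z F = dehom z G"
  shows "F = G"
proof (rule poly_mapping_eqI)
  fix m
  show "Poly_Mapping.lookup F m = Poly_Mapping.lookup G m"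
  proof (cases "mdeg m = n")
    case True
    define l where "l = Poly_Mapping.lookup m (z + 1)"
    have "l \<le> n" "m = mono2 z n l"
      using True eq_mono2[of m n z] mdeg_two[of m z] by (simp_all add: l_def)
    then show ?thesis
      using coeff_dehom[OF assms(1), of z l] coeff_dehom[OF assms(2), of z l] assms(3) by simp
  next
    case False
    then show ?thesis using assms(1,2) by (metis is_form_def in_keys_iff)
  qed
qed

definition homogenize :: "2 \<Rightarrow> nat \<Rightarrow> 'a::comm_ring_1 poly \<Rightarrow> (2, 'a) mpoly" where
  "homogenize z n p = (\<Sum>l\<le>n. Poly_Mapping.single (mono2 z n l) (coeff p l))"

lemma is_form_homogenize: "is_form n (homogenize z n p)"
  unfolding homogenize_def by (intro is_form_sum) (use is_form_single mdeg_mono2 in \<open>metis atMost_iff\<close>)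

lemma dehom_homogenize: "degree p \<le> n \<Longrightarrow> dehom z (homogenize z n p) = p"
proof -
  interpret comm_ring_hom "dehom z :: (2, 'a) mpoly \<Rightarrow> _" by (rule dehom_hom)
  assume "degree p \<le> n"
  then show ?thesis
    by (simp add: homogenize_def hom_sum dehom_single lookup_mono2 poly_as_sum_of_monoms')
qed

lemma dehom_Var: "dehom z (Var z) = 1" "dehom z (Var (z + 1)) = [:0, 1:]"
  by (simp_all add: dehom_def)

lemma dehom_Const: "dehom z (Const c) = [:c:]"
  by (simp add: dehom_def)

text \<open>Homogenizing the coefficients turns a relation between dehomogenizations into one between
  forms, because a form is determined by its degree and its dehomogenization.\<close>

lemma homogenize_combination:
  fixes g :: "3 \<Rightarrow> (2, 'a::comm_ring_1) mpoly"
  assumes g: "\<And>i. is_form d (g i)" and a: "\<And>i. degree (a i) + d \<le> n"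
    and eq: "(\<Sum>i\<in>UNIV. a i * dehom z (g i)) = dehom z F" and F: "is_form n F"
  shows "(\<Sum>i\<in>UNIV. homogenize z (n - d) (a i) * g i) = F"
proof (rule dehom_inject[OF _ F])
  interpret comm_ring_hom "dehom z :: (2, 'a) mpoly \<Rightarrow> _" by (rule dehom_hom)
  have "n - d + d = n" using a[of undefined] by simp
  then show "is_form n (\<Sum>i\<in>UNIV. homogenize z (n - d) (a i) * g i)"
    using is_form_mult[OF is_form_homogenize g, of "n - d" z "a _"] by (intro is_form_sum) metis
  have "degree (a i) \<le> n - d" for i using a[of i] by simp
  then show "dehom z (\<Sum>i\<in>UNIV. homogenize z (n - d) (a i) * g i) = dehom z F"
    by (simp add: hom_sum hom_mult dehom_homogenize eq)
qed

section \<open>Base points and the Nullstellensatz\<close>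

lemma comm_ring_hom_to_ac: "comm_ring_hom to_ac"
  by unfold_locales simp_all

text \<open>The Nullstellensatz in one variable: the ideal generated by the \<open>p i\<close> is principal, and a
  generator that is not a unit has a root in the algebraic closure.\<close>

lemma unit_combination_or_common_root:
  fixes p :: "3 \<Rightarrow> 'a::field poly"
  shows "(\<exists>a. (\<Sum>i\<in>UNIV. a i * p i) = 1) \<or>
    (\<exists>\<alpha>. \<forall>i. poly (map_poly to_ac (p i)) \<alpha> = 0)"
proof (cases "\<forall>i. p i = 0")
  case True
  then show ?thesis by auto
next
  case False
  define I where "I = {q. \<exists>a. q = (\<Sum>i\<in>UNIV. a i * p i)}"
  have gen: "p i \<in> I" for i
    unfolding I_def by (intro CollectI exI[of _ "\<lambda>j. if j = i then 1 else 0"])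
      (simp add: if_distrib[of "\<lambda>x. x * _"] sum.delta cong: if_cong)
  have mult: "r * q \<in> I" if q: "q \<in> I" for r q
  proof -
    obtain a where "q = (\<Sum>i\<in>UNIV. a i * p i)" using q unfolding I_def by blast
    then show ?thesis unfolding I_def
      by (intro CollectI exI[of _ "\<lambda>i. r * a i"]) (simp add: sum_distrib_left mult.assoc)
  qed
  have diff: "q - r \<in> I" if qr: "q \<in> I" "r \<in> I" for r q
  proof -
    obtain a b where "q = (\<Sum>i\<in>UNIV. a i * p i)" "r = (\<Sum>i\<in>UNIV. b i * p i)"
      using qr unfolding I_def by blast
    then show ?thesis unfolding I_def
      by (intro CollectI exI[of _ "\<lambda>i. a i - b i"]) (simp add: sum_subtractf left_diff_distrib)
  qed
  obtain q where q: "q \<in> I" "q \<noteq> 0" and least: "\<And>r. r \<in> I \<Longrightarrow> r \<noteq> 0 \<Longrightarrow> degree q \<le> degree r"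
    using ex_has_least_nat[of "\<lambda>q. q \<in> I \<and> q \<noteq> 0" _ degree] False gen by metis
  have dvd: "q dvd p i" for i
  proof -
    have "p i mod q = p i - p i div q * q" by (simp add: minus_div_mult_eq_mod)
    then have "p i mod q \<in> I" using diff[OF gen mult[OF q(1)]] by metis
    then have "p i mod q = 0"
      using least[of "p i mod q"] degree_mod_less[OF q(2), of "p i"] by linarith
    then show ?thesis by (rule mod_0_imp_dvd)
  qed
  show ?thesis
  proof (cases "degree q = 0")
    case True
    then obtain c where "q = [:c:]" "c \<noteq> 0" using q(2) by (metis degree_eq_zeroE pCons_0_0)
    then have "1 \<in> I" using mult[OF q(1), of "[:inverse c:]"] by (simp add: one_pCons)
    then show ?thesis by (auto simp: I_def)
  next
    case False
    interpret map_poly_comm_ring_hom to_ac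
      unfolding map_poly_comm_ring_hom_def by (rule comm_ring_hom_to_ac)
    have "degree (map_poly to_ac q) = degree q" by (simp add: degree_map_poly)
    then obtain \<alpha> where \<alpha>: "poly (map_poly to_ac q) \<alpha> = 0"
      using alg_closed_imp_poly_has_root[of "map_poly to_ac q"] False by auto
    have "poly (map_poly to_ac (p i)) \<alpha> = 0" for i
      using dvd[of i] \<alpha> by (auto simp: dvd_def hom_mult)
    then show ?thesis by auto
  qed
qed

lemma poly_dehom:
  "poly (map_poly to_ac (dehom z F)) \<alpha> = eval_hom to_ac (\<lambda>i. if i = z then 1 else \<alpha>) F"
proof -
  interpret map_poly_comm_ring_hom to_ac
    unfolding map_poly_comm_ring_hom_def by (rule comm_ring_hom_to_ac)
  have "comm_ring_hom (\<lambda>p. poly (map_poly to_ac p) \<alpha>)"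
    by unfold_locales (simp_all add: hom_add hom_mult)
  moreover have "poly (map_poly to_ac [:c:]) \<alpha> = to_ac c" for c :: 'a
    by (cases "c = 0") simp_all
  ultimately show ?thesis
    using hom_eval_hom[of "\<lambda>p. poly (map_poly to_ac p) \<alpha>" "\<lambda>c. [:c:]" "\<lambda>i. if i = z then 1 else [:0, 1:]" F]
    by (simp add: dehom_def if_distrib[of "\<lambda>x. poly (map_poly to_ac x) \<alpha>"] cong: if_cong)
qed

text \<open>A nonzero vector \<open>v\<close> over the algebraic closure defines a point of the projective line, namely
  the kernel of the homomorphism to polynomials in one new variable \<open>w\<close> that sends the variable
  \<open>i\<close> to \<open>v i * w\<close>. The kernel is prime because the target is a domain, and homogeneous
  because the component of degree \<open>e\<close> is mapped to the term with \<open>w\<^sup>e\<close>.\<close>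

lemma base_points_zero:
  fixes g :: "3 \<Rightarrow> (2, 'a::field) mpoly"
  assumes g: "g \<in> triples d" and v: "v z \<noteq> 0" and zero: "\<And>i. eval_hom to_ac v (g i) = 0"
  shows "base_points g \<noteq> {}"
proof -
  define \<phi> :: "(2, 'a) mpoly \<Rightarrow> 'a alg_closure poly" where
    "\<phi> = eval_hom (\<lambda>c. [:to_ac c:]) (\<lambda>i. monom (v i) 1)"
  have hc: "comm_ring_hom (\<lambda>c. [:to_ac (c::'a):])"
    by (rule comm_ring_hom_comp[OF comm_ring_hom_const_poly comm_ring_hom_to_ac])
  have hom: "comm_ring_hom \<phi>"
    unfolding \<phi>_def by (rule comm_ring_hom_eval_hom[OF hc])
  interpret \<phi>: comm_ring_hom \<phi> by (rule hom)
  have form: "\<phi> F = monom (eval_hom to_ac v F) e" if "is_form e F" for e F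
  proof -
    have "\<phi> F * 1 ^ e = eval_hom (\<lambda>c. [:to_ac c:]) (\<lambda>i. [:v i:]) F * [:0, 1:] ^ e"
      unfolding \<phi>_def by (rule eval_hom_proportional[OF _ that]) (simp add: monom_altdef)
    also have "eval_hom (\<lambda>c. [:to_ac c:]) (\<lambda>i. [:v i:]) F = [:eval_hom to_ac v F:]"
      using hom_eval_hom[OF comm_ring_hom_const_poly, of to_ac v F] by simp
    finally show ?thesis by (simp add: monom_altdef)
  qed
  have comp: "\<phi> (component e F) = 0" if "\<phi> F = 0" for e F
  proof -
    let ?E = "insert e (mdeg ` Poly_Mapping.keys F)"
    have "F = (\<Sum>e\<in>?E. component e F)"
      by (rule poly_mapping_eqI) (auto simp: lookup_component lookup_sum sum.delta in_keys_iff)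
    then have "\<phi> F = (\<Sum>f\<in>?E. \<phi> (component f F))" by (metis \<phi>.hom_sum)
    also have "\<dots> = (\<Sum>f\<in>?E. monom (eval_hom to_ac v (component f F)) f)"
      by (intro sum.cong refl form is_form_component)
    finally have "coeff (\<phi> F) e = eval_hom to_ac v (component e F)"
      by (simp add: coeff_sum)
    with that have "eval_hom to_ac v (component e F) = 0" by simp
    then show ?thesis using form[OF is_form_component, of e F] by simp
  qed
  have "\<phi> -` {0} \<in> Proj"
    unfolding Proj_iff
  proof (intro conjI ballI allI)
    show "primeideal (\<phi> -` {0}) ring_of_type_algebra"
      by (rule primeideal_vimage[OF hom primeideal_0])
    show "\<exists>i. Var i \<notin> \<phi> -` {0}"
      using v by (intro exI[of _ z]) (simp add: \<phi>_def)
  qed (use comp in auto)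
  moreover have "g i \<in> \<phi> -` {0}" for i
    using form[of d "g i"] g zero by (simp add: triples_def)
  ultimately show ?thesis by (metis base_points_iff empty_iff)
qed

lemma Var_power_combination:
  fixes g :: "3 \<Rightarrow> (2, 'a::field) mpoly"
  assumes g: "g \<in> triples d" and bpf: "base_points g = {}"
  obtains n A where "\<And>i. is_form n (A i)" "(\<Sum>i\<in>UNIV. A i * g i) = Var z ^ (n + d)"
proof -
  have gf: "is_form d (g i)" for i using g by (simp add: triples_def)
  have "\<nexists>\<alpha>. \<forall>i. poly (map_poly to_ac (dehom z (g i))) \<alpha> = 0"
  proof
    assume "\<exists>\<alpha>. \<forall>i. poly (map_poly to_ac (dehom z (g i))) \<alpha> = 0"
    then obtain \<alpha> where "\<And>i. eval_hom to_ac (\<lambda>i. if i = z then 1 else \<alpha>) (g i) = 0"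
      by (auto simp: poly_dehom)
    then show False
      using base_points_zero[OF g, of "\<lambda>i. if i = z then 1 else \<alpha>" z] bpf by simp
  qed
  then obtain a where a: "(\<Sum>i\<in>UNIV. a i * dehom z (g i)) = 1"
    using unit_combination_or_common_root[of "\<lambda>i. dehom z (g i)"] by blast
  define n where "n = (\<Sum>i\<in>UNIV. degree (a i))"
  have n: "degree (a i) \<le> n" for i
    unfolding n_def by (rule member_le_sum) simp_all
  interpret comm_ring_hom "dehom z :: (2, 'a) mpoly \<Rightarrow> _" by (rule dehom_hom)
  have "(\<Sum>i\<in>UNIV. homogenize z (n + d - d) (a i) * g i) = Var z ^ (n + d)"
    by (rule homogenize_combination)
      (use gf n a is_form_power[OF is_form_Var, of "n + d" z] in \<open>simp_all add: hom_power dehom_Var\<close>)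
  then show thesis
    using that[of n "\<lambda>i. homogenize z n (a i)"] by (simp add: is_form_homogenize)
qed

text \<open>Powers of both variables lie in the ideal of \<open>g\<close>, and every monomial of large degree
  is a multiple of one of these two powers. The bound on \<open>degree (a i)\<close> records that the
  identity comes from forms of degree \<open>n\<close>.\<close>

lemma base_point_free_imp_combination:
  fixes g :: "3 \<Rightarrow> (2, 'a::field) mpoly"
  assumes g: "g \<in> triples d" and bpf: "base_points g = {}"
  obtains m where "\<And>n b. m \<le> n \<Longrightarrow> b \<le> n \<Longrightarrow>
    \<exists>a. (\<forall>i. degree (a i) + d \<le> n) \<and> (\<Sum>i\<in>UNIV. a i * dehom 0 (g i)) = monom 1 b"
proof -
  interpret comm_ring_hom "dehom 0 :: (2, 'a) mpoly \<Rightarrow> _" by (rule dehom_hom)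
  obtain k A where A: "\<And>i. is_form k (A i)" "(\<Sum>i\<in>UNIV. A i * g i) = Var 0 ^ (k + d)"
    using Var_power_combination[OF assms, where z = 0] by blast
  obtain l B where B: "\<And>i. is_form l (B i)" "(\<Sum>i\<in>UNIV. B i * g i) = Var (0 + 1) ^ (l + d)"
    using Var_power_combination[OF assms, where z = "0 + 1"] by blast
  have one: "(\<Sum>i\<in>UNIV. dehom 0 (A i) * dehom 0 (g i)) = 1"
    using arg_cong[OF A(2), of "dehom 0"] by (simp add: hom_sum hom_mult hom_power dehom_Var)
  have pow: "(\<Sum>i\<in>UNIV. dehom 0 (B i) * dehom 0 (g i)) = monom 1 (l + d)"
    using arg_cong[OF B(2), of "dehom 0"]
    by (simp add: dehom_Var(2)[of 0, simplified] hom_sum hom_mult hom_power monom_altdef)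
  have "\<exists>a. (\<forall>i. degree (a i) + d \<le> n) \<and> (\<Sum>i\<in>UNIV. a i * dehom 0 (g i)) = monom 1 b"
    if n: "k + l + 2 * d \<le> n" "b \<le> n" for n b
  proof (cases "l + d \<le> b")
    case True
    have "degree (monom 1 (b - (l + d)) * dehom 0 (B i)) + d \<le> n" for i
      using degree_mult_le[of "monom 1 (b - (l + d))" "dehom 0 (B i)"]
        degree_dehom[OF B(1), of 0 i] degree_monom_le[of "1::'a" "b - (l + d)"] True n by linarith
    moreover have "(\<Sum>i\<in>UNIV. (monom 1 (b - (l + d)) * dehom 0 (B i)) * dehom 0 (g i)) = monom 1 b"
      using pow True by (simp add: mult.assoc mult_monom flip: sum_distrib_left)
    ultimately show ?thesis by (intro exI[of _ "\<lambda>i. monom 1 (b - (l + d)) * dehom 0 (B i)"]) simp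
  next
    case False
    have "degree (monom 1 b * dehom 0 (A i)) + d \<le> n" for i
      using degree_mult_le[of "monom 1 b" "dehom 0 (A i)"]
        degree_dehom[OF A(1), of 0 i] degree_monom_le[of "1::'a" b] False n by linarith
    moreover have "(\<Sum>i\<in>UNIV. (monom 1 b * dehom 0 (A i)) * dehom 0 (g i)) = monom 1 b"
      using one by (simp add: mult.assoc flip: sum_distrib_left)
    ultimately show ?thesis by (intro exI[of _ "\<lambda>i. monom 1 b * dehom 0 (A i)"]) simp
  qed
  then show thesis using that by blast
qed

text \<open>The exponents \<open>0\<close> and \<open>n\<close> belong to the \<open>n\<close>-th powers of the two variables. A point at which all
  \<open>g i\<close> vanish would contain both powers and hence both variables.\<close>

lemma base_point_freeI:
  fixes g :: "3 \<Rightarrow> (2, 'a::field) mpoly"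
  assumes g: "g \<in> triples d" and "\<delta> \<noteq> 0"
    and ends: "\<And>b. b = 0 \<or> b = n \<Longrightarrow>
      \<exists>a. (\<forall>i. degree (a i) + d \<le> n) \<and> (\<Sum>i\<in>UNIV. a i * dehom 0 (g i)) = monom \<delta> b"
  shows "base_points g = {}"
proof -
  have gf: "is_form d (g i)" for i using g by (simp add: triples_def)
  interpret comm_ring_hom "dehom 0 :: (2, 'a) mpoly \<Rightarrow> _" by (rule dehom_hom)
  have pow: "Var z ^ n \<in> P" if P: "P \<in> Proj" "\<And>i. g i \<in> P" for P z
  proof -
    define b where "b = (if z = 0 then 0 else n)"
    have "b = 0 \<or> b = n" by (simp add: b_def)
    from ends[OF this] obtain a where a: "\<And>i. degree (a i) + d \<le> n"
        "(\<Sum>i\<in>UNIV. a i * dehom 0 (g i)) = monom \<delta> b"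
      by blast
    have "monom \<delta> b = dehom 0 (Const \<delta> * Var z ^ n)"
      using two_cases[of z 0]
      by (auto simp: dehom_Var(1) dehom_Var(2)[of 0, simplified] b_def hom_mult hom_power dehom_Const monom_altdef)
    then have "(\<Sum>i\<in>UNIV. homogenize 0 (n - d) (a i) * g i) = Const \<delta> * Var z ^ n"
      using is_form_Const_mult[OF is_form_power[OF is_form_Var], of n \<delta> z] a
      by (intro homogenize_combination gf) simp_all
    moreover have I: "ideal P ring_of_type_algebra" using P by (simp add: Proj_iff primeideal_type_iff)
    then have "(\<Sum>i\<in>UNIV. homogenize 0 (n - d) (a i) * g i) \<in> P"
      using P(2) by (intro ideal_sum) (auto simp: ideal_type_iff)
    ultimately have "Const (inverse \<delta>) * (Const \<delta> * Var z ^ n) \<in> P"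
      using I by (auto simp: ideal_type_iff)
    moreover have "Const (inverse \<delta>) * Const \<delta> = (1 :: (2, 'a) mpoly)"
      using \<open>\<delta> \<noteq> 0\<close> by (simp add: Const_def mult_single single_one)
    ultimately show ?thesis by (simp flip: mult.assoc)
  qed
  have "Var z \<in> P" if "P \<in> Proj" "\<And>i. g i \<in> P" for P z
    using pow[OF that, of z] that(1) primeideal_power by (auto simp: Proj_iff)
  then show ?thesis by (metis base_points_iff Proj_iff equals0I)
qed

section \<open>Nonzero minors\<close>

text \<open>The determinant is multilinear in the rows, so the given determinant is a linear
  combination of the determinants whose rows are chosen among the \<open>V \<sigma>\<close>.\<close>

lemma det_nonzero_row_choice:
  fixes V :: "'s \<Rightarrow> nat \<Rightarrow> 'r::comm_ring_1"
  assumes S: "finite S" and nz: "det (mat n n (\<lambda>(i, j). \<Sum>\<sigma>\<in>S. A i \<sigma> * V \<sigma> j)) \<noteq> 0"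
  shows "\<exists>\<rho>. (\<forall>i<n. \<rho> i \<in> S) \<and> det (mat n n (\<lambda>(i, j). V (\<rho> i) j)) \<noteq> 0"
proof (rule ccontr)
  assume neg: "\<not> ?thesis"
  let ?P = "{p. p permutes {0..<n}}" and ?F = "PiE {0..<n} (\<lambda>_. S)"
  have px: "p i < n" if "p \<in> ?P" "i \<in> {0..<n}" for p i
    using that permutes_in_image[of p "{0..<n}" i] by auto
  have "det (mat n n (\<lambda>(i, j). \<Sum>\<sigma>\<in>S. A i \<sigma> * V \<sigma> j)) =
      (\<Sum>p\<in>?P. signof p * (\<Prod>i=0..<n. \<Sum>\<sigma>\<in>S. A i \<sigma> * V \<sigma> (p i)))"
    by (subst det_def'[of _ n]) (auto intro!: sum.cong prod.cong arg_cong2[of _ _ _ _ "(*)"] simp: px)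
  also have "\<dots> = (\<Sum>p\<in>?P. \<Sum>\<rho>\<in>?F. signof p * ((\<Prod>i=0..<n. A i (\<rho> i)) * (\<Prod>i=0..<n. V (\<rho> i) (p i))))"
    by (simp add: prod_sum_PiE S sum_distrib_left prod.distrib)
  also have "\<dots> = (\<Sum>\<rho>\<in>?F. \<Sum>p\<in>?P. signof p * ((\<Prod>i=0..<n. A i (\<rho> i)) * (\<Prod>i=0..<n. V (\<rho> i) (p i))))"
    by (rule sum.swap)
  also have "\<dots> = (\<Sum>\<rho>\<in>?F. (\<Prod>i=0..<n. A i (\<rho> i)) * det (mat n n (\<lambda>(i, j). V (\<rho> i) j)))"
  proof (rule sum.cong)
    fix \<rho> assume "\<rho> \<in> ?F"
    have "det (mat n n (\<lambda>(i, j). V (\<rho> i) j)) = (\<Sum>p\<in>?P. signof p * (\<Prod>i=0..<n. V (\<rho> i) (p i)))"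
      by (subst det_def'[of _ n]) (auto intro!: sum.cong prod.cong arg_cong2[of _ _ _ _ "(*)"] simp: px)
    then show "(\<Sum>p\<in>?P. signof p * ((\<Prod>i=0..<n. A i (\<rho> i)) * (\<Prod>i=0..<n. V (\<rho> i) (p i)))) =
      (\<Prod>i=0..<n. A i (\<rho> i)) * det (mat n n (\<lambda>(i, j). V (\<rho> i) j))"
      by (simp add: sum_distrib_left mult_ac)
  qed simp
  also have "\<dots> = 0"
  proof (rule sum.neutral, intro ballI)
    fix \<rho> assume "\<rho> \<in> ?F"
    then have "\<forall>i<n. \<rho> i \<in> S" by (auto simp: PiE_def Pi_def)
    then have "det (mat n n (\<lambda>(i, j). V (\<rho> i) j)) = 0" using neg by blast
    then show "(\<Prod>i=0..<n. A i (\<rho> i)) * det (mat n n (\<lambda>(i, j). V (\<rho> i) j)) = 0" by simp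
  qed
  finally show False using nz by simp
qed

interpretation poly_module: Modules.module "smult :: 'r::comm_ring_1 \<Rightarrow> 'r poly \<Rightarrow> 'r poly"
  by unfold_locales (simp_all add: smult_add_right smult_add_left)

text \<open>Since \<open>b\<close> is the lowest exponent of \<open>p b\<close>, the coefficients form a triangular matrix with nonzero
  determinant. Its rows are combinations of elements of \<open>S\<close>, so multilinearity applies.\<close>

lemma exists_nonzero_minor:
  fixes p :: "nat \<Rightarrow> 'r::idom poly"
  assumes S: "finite S" and p: "\<And>b. b < n \<Longrightarrow> p b \<in> poly_module.span S"
    and low: "\<And>b j. b < n \<Longrightarrow> j < b \<Longrightarrow> coeff (p b) j = 0" and diag: "\<And>b. b < n \<Longrightarrow> coeff (p b) b \<noteq> 0"
  shows "\<exists>\<rho>. (\<forall>i<n. \<rho> i \<in> S) \<and> det (mat n n (\<lambda>(i, j). coeff (\<rho> i) j)) \<noteq> 0"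
proof -
  have "\<exists>A. p b = (\<Sum>v\<in>S. smult (A v) v)" if "b < n" for b
    using p[OF that] by (auto simp: poly_module.span_finite[OF S])
  then obtain A where A: "\<And>b. b < n \<Longrightarrow> p b = (\<Sum>v\<in>S. smult (A b v) v)" by metis
  let ?M = "mat n n (\<lambda>(i, j). \<Sum>v\<in>S. A i v * coeff v j)"
  have M: "?M $$ (i, j) = coeff (p i) j" if "i < n" "j < n" for i j
    using that by (simp add: A coeff_sum)
  have "upper_triangular ?M"
    by (rule upper_triangularI) (use M low in auto)
  then have "det ?M = prod_list (diag_mat ?M)"
    by (rule det_upper_triangular[of _ n]) simp
  also have "\<dots> \<noteq> 0"
    using M diag by (auto simp: diag_mat_def prod_list_zero_iff)
  finally show ?thesis
    by (rule det_nonzero_row_choice[OF S])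
qed

lemma det_replace_col_smult:
  assumes A: "A \<in> carrier_mat n n" and c: "c \<in> carrier_vec n" and k: "k < n"
  shows "det (replace_col A (a \<cdot>\<^sub>v c) k) = a * det (replace_col A c k)"
proof -
  have cof: "cofactor (replace_col A v k) i k = cofactor A i k" if "i < n" for i v
  proof -
    have "mat_delete (replace_col A v k) i k = mat_delete A i k"
      using A by (intro eq_matI) (auto simp: mat_delete_def replace_col_def)
    then show ?thesis by (simp add: cofactor_def)
  qed
  have "det (replace_col A v k) = (\<Sum>i<n. v $ i * cofactor A i k)" for v
  proof -
    have "replace_col A v k \<in> carrier_mat n n" using A by (simp add: replace_col_def)
    then have "det (replace_col A v k) = (\<Sum>i<n. replace_col A v k $$ (i, k) * cofactor (replace_col A v k) i k)"
      by (rule laplace_expansion_column[OF _ k])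
    also have "\<dots> = (\<Sum>i<n. v $ i * cofactor A i k)"
      using A k by (intro sum.cong refl) (simp add: cof, simp add: replace_col_def)
    finally show ?thesis .
  qed
  then show ?thesis using c by (simp add: sum_distrib_left mult.assoc)
qed

section \<open>The minors that detect base points\<close>

text \<open>Writing \<open>multiple_row G (a, i)\<close> with \<open>a + d \<le> n\<close> as a row of \<open>n + 1\<close> coefficients represents the
  product of \<open>g i\<close> with a monomial of degree \<open>n - d\<close>.\<close>

definition multiple_row :: "(3 \<Rightarrow> 'a::comm_ring_1 poly) \<Rightarrow> nat \<times> 3 \<Rightarrow> 'a poly" where
  "multiple_row G = (\<lambda>(a, i). monom 1 a * G i)"

lemma combination_in_span:
  fixes G :: "3 \<Rightarrow> 'a::comm_ring_1 poly"
  assumes "\<And>i. degree (a i) + d \<le> n"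
  shows "(\<Sum>i\<in>UNIV. a i * G i) \<in> poly_module.span (multiple_row G ` {(a, i). a + d \<le> n})"
proof (intro poly_module.span_sum)
  fix i :: 3
  have "a i * G i = (\<Sum>l\<le>degree (a i). smult (coeff (a i) l) (monom 1 l * G i))"
    by (subst poly_as_sum_of_monoms[symmetric, of "a i"])
      (simp add: sum_distrib_right smult_monom flip: mult_smult_left)
  also have "\<dots> \<in> poly_module.span (multiple_row G ` {(a, i). a + d \<le> n})"
    using assms[of i]
    by (intro poly_module.span_sum poly_module.span_scale poly_module.span_base)
      (force simp: multiple_row_def)
  finally show "a i * G i \<in> poly_module.span (multiple_row G ` {(a, i). a + d \<le> n})" .
qed

lemma finite_shifts: "finite {(a, i::'x::finite). a + d \<le> (n::nat)}"
  by (rule finite_subset[of _ "{..n} \<times> UNIV"]) auto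

lemma base_point_free_imp_minor:
  fixes g :: "3 \<Rightarrow> (2, 'a::field) mpoly"
  assumes "g \<in> triples d" "base_points g = {}"
  shows "\<exists>n \<rho>. (\<forall>i\<le>n. fst (\<rho> i) + d \<le> n) \<and>
    det (mat (Suc n) (Suc n) (\<lambda>(i, j). coeff (multiple_row (\<lambda>i. dehom 0 (g i)) (\<rho> i)) j)) \<noteq> 0"
proof -
  let ?G = "\<lambda>i. dehom 0 (g i)"
  obtain n where comb: "\<And>b. b \<le> n \<Longrightarrow>
    \<exists>a. (\<forall>i. degree (a i) + d \<le> n) \<and> (\<Sum>i\<in>UNIV. a i * ?G i) = monom 1 b"
    using base_point_free_imp_combination[OF assms] by (metis order_refl)
  let ?S = "multiple_row ?G ` {(a, i). a + d \<le> n}"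
  have "finite ?S" by (intro finite_imageI finite_shifts)
  moreover have "monom 1 b \<in> poly_module.span ?S" if b: "b < Suc n" for b
  proof -
    obtain a where a: "\<And>i. degree (a i) + d \<le> n" and eq: "(\<Sum>i\<in>UNIV. a i * ?G i) = monom 1 b"
      using comb[of b] b by auto
    have "(\<Sum>i\<in>UNIV. a i * ?G i) \<in> poly_module.span ?S"
      by (rule combination_in_span[OF a])
    then show ?thesis by (simp only: eq)
  qed
  ultimately have "\<exists>\<rho>. (\<forall>i<Suc n. \<rho> i \<in> ?S) \<and> det (mat (Suc n) (Suc n) (\<lambda>(i, j). coeff (\<rho> i) j)) \<noteq> 0"
    by (rule exists_nonzero_minor) simp_all
  then obtain \<rho> where \<rho>: "\<And>i. i < Suc n \<Longrightarrow> \<rho> i \<in> ?S"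
    and nz: "det (mat (Suc n) (Suc n) (\<lambda>(i, j). coeff (\<rho> i) j)) \<noteq> 0" by blast
  have "\<exists>s. fst s + d \<le> n \<and> \<rho> i = multiple_row ?G s" if "i < Suc n" for i
    using \<rho>[OF that] by force
  then obtain s where s: "\<And>i. i < Suc n \<Longrightarrow> fst (s i) + d \<le> n \<and> \<rho> i = multiple_row ?G (s i)" by metis
  have "mat (Suc n) (Suc n) (\<lambda>(i, j). coeff (\<rho> i) j) =
    mat (Suc n) (Suc n) (\<lambda>(i, j). coeff (multiple_row ?G (s i)) j)"
    by (rule eq_matI) (use s in auto)
  then show ?thesis using nz s by (metis less_Suc_eq_le)
qed

text \<open>Multiplication with the adjugate writes the determinant times any monomial of degree \<open>n\<close> as a
  combination of the rows.\<close>

lemma minor_imp_base_point_free: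
  fixes g :: "3 \<Rightarrow> (2, 'a::field) mpoly"
  assumes g: "g \<in> triples d" and \<rho>: "\<And>i. i \<le> n \<Longrightarrow> fst (\<rho> i) + d \<le> n"
    and nz: "det (mat (Suc n) (Suc n) (\<lambda>(i, j). coeff (multiple_row (\<lambda>i. dehom 0 (g i)) (\<rho> i)) j)) \<noteq> 0"
  shows "base_points g = {}"
proof -
  let ?G = "\<lambda>i. dehom 0 (g i)"
  define M where "M = mat (Suc n) (Suc n) (\<lambda>(i, j). coeff (multiple_row ?G (\<rho> i)) j)"
  have M_entry: "M $$ (i, j) = coeff (multiple_row ?G (\<rho> i)) j" if "i \<le> n" "j \<le> n" for i j
    using that by (simp add: M_def)
  have degG: "degree (?G i) \<le> d" for i
    using degree_dehom g by (auto simp: triples_def)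
  have M: "M \<in> carrier_mat (Suc n) (Suc n)" by (simp add: M_def)
  note adj = adj_mat[OF M]
  show ?thesis
  proof (rule base_point_freeI[OF g nz[folded M_def], of n])
    fix b assume "b = 0 \<or> b = n"
    then have b: "b \<le> n" by auto
    let ?c = "\<lambda>k. adj_mat M $$ (b, k)"
    define a where "a i = (\<Sum>k\<le>n. if snd (\<rho> k) = i then monom (?c k) (fst (\<rho> k)) else 0)" for i
    have "degree (a i) + d \<le> n" for i
    proof -
      have "degree (a i) \<le> n - d"
        unfolding a_def
      proof (rule degree_sum_le)
        fix k assume "k \<in> {..n}"
        then show "degree (if snd (\<rho> k) = i then monom (?c k) (fst (\<rho> k)) else 0) \<le> n - d"
          using \<rho>[of k] order_trans[OF degree_monom_le[of "?c k" "fst (\<rho> k)"], of "n - d"] by auto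
      qed simp
      then show ?thesis using \<rho>[of 0] by simp
    qed
    moreover have "(\<Sum>i\<in>UNIV. a i * ?G i) = monom (det M) b"
    proof -
      have "(\<Sum>i\<in>UNIV. a i * ?G i) = (\<Sum>k\<le>n. \<Sum>i\<in>UNIV. if i = snd (\<rho> k) then monom (?c k) (fst (\<rho> k)) * ?G i else 0)"
        unfolding a_def sum_distrib_right
        by (subst sum.swap) (auto intro!: sum.cong)
      also have "\<dots> = (\<Sum>k\<le>n. monom (?c k) (fst (\<rho> k)) * ?G (snd (\<rho> k)))"
        by (simp add: sum.delta)
      also have "\<dots> = (\<Sum>k\<le>n. smult (?c k) (multiple_row ?G (\<rho> k)))"
        by (simp add: multiple_row_def case_prod_beta smult_monom flip: mult_smult_left)
      also have "\<dots> = monom (det M) b"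
      proof (rule poly_eqI)
        fix j
        show "coeff (\<Sum>k\<le>n. smult (?c k) (multiple_row ?G (\<rho> k))) j = coeff (monom (det M) b) j"
        proof (cases "j \<le> n")
          case True
          have "coeff (\<Sum>k\<le>n. smult (?c k) (multiple_row ?G (\<rho> k))) j = (\<Sum>k<Suc n. ?c k * M $$ (k, j))"
            using True by (auto simp: coeff_sum lessThan_Suc_atMost M_entry intro!: sum.cong)
          also have "\<dots> = (adj_mat M * M) $$ (b, j)"
            using b True carrier_matD[OF adj(1)] carrier_matD[OF M]
            by (simp add: scalar_prod_def lessThan_atLeast0)
          also have "\<dots> = coeff (monom (det M) b) j"
            unfolding adj(3) using b True by simp
          finally show ?thesis .
        next
          case False
          have "degree (multiple_row ?G (\<rho> k)) \<le> n" if "k \<le> n" for k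
            using degree_mult_le[of "monom 1 (fst (\<rho> k))" "?G (snd (\<rho> k))"] degG[of "snd (\<rho> k)"]
              \<rho>[OF that] degree_monom_le[of "1::'a" "fst (\<rho> k)"]
            unfolding multiple_row_def case_prod_beta by linarith
          then have "coeff (multiple_row ?G (\<rho> k)) j = 0" if "k \<le> n" for k
            using False that by (intro coeff_eq_0) (meson le_less_trans not_le)
          then show ?thesis using False b by (simp add: coeff_sum)
        qed
      qed
      finally show ?thesis .
    qed
    ultimately show "\<exists>a. (\<forall>i. degree (a i) + d \<le> n) \<and> (\<Sum>i\<in>UNIV. a i * ?G i) = monom (det M) b"
      by blast
  qed
qed

section \<open>Koszul relations\<close>

text \<open>In \<open>k[t][s]\<close>, represented by \<open>'a poly poly\<close>, this is \<open>p(s)\<close>, while \<open>[:p:]\<close> is \<open>p(t)\<close>.\<close>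

definition lift_poly :: "'a::comm_ring_1 poly \<Rightarrow> 'a poly poly" where
  "lift_poly = map_poly (\<lambda>c. [:c:])"

lemma lift_poly_hom: "comm_ring_hom (lift_poly :: 'a::comm_ring_1 poly \<Rightarrow> _)"
proof -
  interpret map_poly_comm_ring_hom "\<lambda>c::'a. [:c:]"
    unfolding map_poly_comm_ring_hom_def by (rule comm_ring_hom_const_poly)
  show ?thesis unfolding lift_poly_def by unfold_locales
qed

lemma coeff_lift_poly: "coeff (lift_poly p) l = [:coeff p l:]"
  by (simp add: lift_poly_def coeff_map_poly)

lemma degree_lift_poly: "degree (lift_poly p) = degree p"
  unfolding lift_poly_def by (rule degree_map_poly) simp

lemma lift_poly_monom: "lift_poly (monom c n) = monom [:c:] n"
  by (rule poly_eqI) (simp add: coeff_lift_poly)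

text \<open>The substitution \<open>s = t\<close>.\<close>

lemma poly_lift_poly: "poly (lift_poly p) [:0, 1:] = (p :: 'a::comm_ring_1 poly)"
proof -
  have "poly (lift_poly p) [:0, 1:] = (\<Sum>l\<le>degree p. [:coeff p l:] * [:0, 1:] ^ l)"
    by (simp add: poly_altdef degree_lift_poly coeff_lift_poly)
  also have "\<dots> = (\<Sum>l\<le>degree p. monom (coeff p l) l)"
    by (simp add: monom_altdef)
  also have "\<dots> = p" by (rule poly_as_sum_of_monoms)
  finally show ?thesis .
qed

text \<open>The polynomial \<open>G\<^sub>i(t) G\<^sub>j(s) - G\<^sub>j(t) G\<^sub>i(s)\<close>. It vanishes at \<open>(t, s)\<close> iff the
  points with parameters \<open>t\<close> and \<open>s\<close> have proportional coordinates \<open>i\<close> and \<open>j\<close>.\<close>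

definition koszul :: "(3 \<Rightarrow> 'a::comm_ring_1 poly) \<Rightarrow> 3 \<Rightarrow> 3 \<Rightarrow> 'a poly poly" where
  "koszul G i j = smult (G i) (lift_poly (G j)) - smult (G j) (lift_poly (G i))"

text \<open>The row \<open>(a, i, j)\<close> is \<open>s\<^sup>a\<close> times a Koszul relation. As in the case of base points, the
  condition \<open>a + d \<le> n\<close> bounds its degree in \<open>s\<close> by \<open>n\<close>.\<close>

definition koszul_row :: "(3 \<Rightarrow> 'a::comm_ring_1 poly) \<Rightarrow> nat \<times> 3 \<times> 3 \<Rightarrow> 'a poly poly" where
  "koszul_row G = (\<lambda>(a, i, j). monom 1 a * koszul G i j)"

definition koszul_rows :: "nat \<Rightarrow> (3 \<Rightarrow> 'a::comm_ring_1 poly) \<Rightarrow> nat \<Rightarrow> 'a poly poly set" where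
  "koszul_rows d G n = koszul_row G ` {(a, i). a + d \<le> n}"

abbreviation koszul_span :: "nat \<Rightarrow> (3 \<Rightarrow> 'a::comm_ring_1 poly) \<Rightarrow> nat \<Rightarrow> 'a poly poly set" where
  "koszul_span d G n \<equiv> poly_module.span (koszul_rows d G n)"

lemma koszul_span_mult:
  assumes p: "p \<in> koszul_span d G m" and q: "degree q + m \<le> n"
  shows "q * p \<in> koszul_span d G n"
proof -
  have shift: "monom 1 b * p \<in> koszul_span d G n" if b: "b + m \<le> n" for b
    using p
  proof (induction rule: poly_module.span_induct_alt)
    case base
    show ?case by (simp add: poly_module.span_zero)
  next
    case (step c x y)
    obtain a ij where x: "x = koszul_row G (a, ij)" "a + d \<le> m"
      using step(1) by (auto simp: koszul_rows_def)
    have "monom 1 b * x = koszul_row G (a + b, ij)"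
      by (simp add: x koszul_row_def case_prod_beta mult_monom add.commute flip: mult.assoc)
    moreover have "koszul_row G (a + b, ij) \<in> koszul_rows d G n"
      using x b unfolding koszul_rows_def by (intro imageI) simp
    ultimately have "monom 1 b * x \<in> koszul_span d G n"
      by (simp add: poly_module.span_base)
    then show ?case
      using step by (simp add: distrib_left poly_module.span_add poly_module.span_scale)
  qed
  have "q * p = (\<Sum>b\<le>degree q. smult (coeff q b) (monom 1 b * p))"
    by (subst poly_as_sum_of_monoms[symmetric, of q])
      (simp add: sum_distrib_right smult_monom flip: mult_smult_left)
  also have "\<dots> \<in> koszul_span d G n"
    using q by (intro poly_module.span_sum poly_module.span_scale shift) simp
  finally show ?thesis .
qed

lemma koszul_in_span: "koszul G i j \<in> koszul_span d G d"
proof -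
  have "koszul G i j = koszul_row G (0, i, j)" by (simp add: koszul_row_def flip: one_pCons)
  also have "\<dots> \<in> koszul_span d G d"
    unfolding koszul_rows_def by (intro poly_module.span_base imageI) simp
  finally show ?thesis .
qed

lemma degree_power_le_mult: "degree p \<le> d \<Longrightarrow> degree (p ^ n) \<le> n * d"
  using degree_power_le[of p n] by (metis le_trans mult.commute mult_le_mono1)

text \<open>Scalars are turned into constant factors so that identities in \<open>k[t][s]\<close> become instances of
  identities valid in every commutative ring.\<close>

lemma smult_conv_mult: "smult c p = [:c:] * p"
  by simp

lemma const_poly_mult: "[:a * b:] = [:a:] * [:b :: 'a::comm_ring_1:]"
  by (simp add: mult.commute)

text \<open>Modulo the Koszul relations, \<open>G\<^sub>z(t) G\<^sub>i(s)\<close> may be replaced by \<open>G\<^sub>z(s) G\<^sub>i(t)\<close>. In a form of degree \<open>e\<close>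
  evaluated at \<open>G(s)\<close>, this exchanges the parameter in all \<open>e\<close> factors of every monomial.\<close>

lemma koszul_subst:
  fixes G :: "3 \<Rightarrow> 'a::comm_ring_1 poly"
  assumes deg: "\<And>i. degree (G i) \<le> d" and F: "is_form e F"
  defines "\<Phi> \<equiv> eval_hom (\<lambda>c. [:c:]) G F"
  shows "smult (G z ^ e) (lift_poly \<Phi>) - lift_poly (G z) ^ e * [:\<Phi>:] \<in> koszul_span d G (e * d)"
proof -
  let ?L = "\<lambda>i. lift_poly (G i)"
  interpret L: comm_ring_hom "lift_poly :: 'a poly \<Rightarrow> _" by (rule lift_poly_hom)
  have mono: "smult (G z ^ mdeg m) (lift_poly (mono_eval G m)) - ?L z ^ mdeg m * [:mono_eval G m:]
      \<in> koszul_span d G (mdeg m * d)" for m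
  proof (induction m rule: monomial_induct)
    case zero
    show ?case by (simp add: poly_module.span_zero flip: one_pCons)
  next
    case (step i m)
    let ?k = "mdeg m" and ?M = "mono_eval G m"
    have deg_k: "degree (?L z ^ ?k) \<le> ?k * d"
      by (rule degree_power_le_mult) (simp add: degree_lift_poly deg)
    have "degree (smult (G z) (?L i)) \<le> d"
      using degree_smult_le[of "G z" "?L i"] deg[of i] by (simp add: degree_lift_poly)
    then have 1: "smult (G z) (?L i) * (smult (G z ^ ?k) (lift_poly ?M) - ?L z ^ ?k * [:?M:])
        \<in> koszul_span d G (Suc ?k * d)"
      by (intro koszul_span_mult[OF step]) simp
    have "degree (smult ?M (?L z ^ ?k)) \<le> ?k * d"
      using degree_smult_le deg_k by (rule order_trans)
    then have 2: "smult ?M (?L z ^ ?k) * koszul G z i \<in> koszul_span d G (Suc ?k * d)"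
      by (intro koszul_span_mult[OF koszul_in_span]) simp
    have "smult (G z) (?L i) * (smult (G z ^ ?k) (lift_poly ?M) - ?L z ^ ?k * [:?M:])
        + smult ?M (?L z ^ ?k) * koszul G z i
      = smult (G z ^ Suc ?k) (lift_poly (G i * ?M)) - ?L z ^ Suc ?k * [:G i * ?M:]"
    proof -
      have ring: "x * Li * (k * lM - Lk * M) + M * Lk * (x * Li - gi * Lz)
          = x * k * (Li * lM) - Lz * Lk * (gi * M)" for x Li k lM Lk M gi Lz :: "'a poly poly"
        by (simp add: algebra_simps)
      show ?thesis
        by (simp only: smult_conv_mult koszul_def power_Suc const_poly_mult L.hom_mult ring)
    qed
    then show ?case
      using poly_module.span_add[OF 1 2]
      by (simp add: mono_eval_add mono_eval_single mdeg_add)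
  qed
  have \<Phi>: "\<Phi> = (\<Sum>m\<in>Poly_Mapping.keys F. smult (Poly_Mapping.lookup F m) (mono_eval G m))"
    by (simp add: \<Phi>_def eval_hom_def)
  have "lift_poly \<Phi> = (\<Sum>m\<in>Poly_Mapping.keys F. smult [:Poly_Mapping.lookup F m:] (lift_poly (mono_eval G m)))"
    unfolding \<Phi> L.hom_sum by (intro sum.cong refl poly_eqI) (simp add: coeff_lift_poly mult.commute)
  moreover have "[:\<Phi>:] = (\<Sum>m\<in>Poly_Mapping.keys F. smult [:Poly_Mapping.lookup F m:] [:mono_eval G m:])"
    unfolding \<Phi> by (intro poly_eqI) (simp add: coeff_sum coeff_pCons split: nat.split)
  moreover have ring: "k * (c * l) - Lk * (c * M) = c * (k * l - Lk * M)"
    for k c l Lk M :: "'a poly poly"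
    by (simp add: algebra_simps)
  ultimately have "smult (G z ^ e) (lift_poly \<Phi>) - ?L z ^ e * [:\<Phi>:] =
    (\<Sum>m\<in>Poly_Mapping.keys F. smult [:Poly_Mapping.lookup F m:]
      (smult (G z ^ e) (lift_poly (mono_eval G m)) - ?L z ^ e * [:mono_eval G m:]))"
    by (simp only: poly_module.scale_sum_right sum_distrib_left sum_subtractf[symmetric])
      (intro sum.cong refl, simp only: smult_conv_mult ring)
  also have "\<dots> \<in> koszul_span d G (e * d)"
    using F mono by (intro poly_module.span_sum poly_module.span_scale) (auto simp: is_form_def)
  finally show ?thesis .
qed

text \<open>Every polynomial of large degree is a combination of the \<open>G\<^sub>i(s)\<close>; replacing each \<open>G\<^sub>z(t) G\<^sub>i(s)\<close> by
  \<open>G\<^sub>z(s) G\<^sub>i(t)\<close> moves one factor \<open>G\<^sub>z\<close> from \<open>t\<close> to \<open>s\<close>. Each of the \<open>r\<close> moves lowers the degree of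
  the cofactor by \<open>d\<close>, whence the bound on \<open>n\<close>.\<close>

lemma koszul_trade_powers:
  fixes G :: "3 \<Rightarrow> 'a::comm_ring_1 poly"
  assumes deg: "\<And>i. degree (G i) \<le> d"
    and comb: "\<And>n f. m \<le> n \<Longrightarrow> degree f \<le> n \<Longrightarrow>
      \<exists>a. (\<forall>i. degree (a i) + d \<le> n) \<and> (\<Sum>i\<in>UNIV. a i * lift_poly (G i)) = f"
    and n: "m + r * d \<le> n" "degree f \<le> n"
  shows "\<exists>A. degree A + r * d \<le> n \<and> smult (G z ^ r) f - lift_poly (G z) ^ r * A \<in> koszul_span d G n"
  using n(1)
proof (induction r)
  case 0
  then show ?case using n(2) by (intro exI[of _ f]) (simp add: poly_module.span_zero)
next
  case (Suc r)
  let ?L = "\<lambda>i. lift_poly (G i)"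
  obtain A where A: "degree A + r * d \<le> n" "smult (G z ^ r) f - ?L z ^ r * A \<in> koszul_span d G n"
    using Suc by auto
  obtain a where a: "\<And>i. degree (a i) + d \<le> n - r * d" "(\<Sum>i\<in>UNIV. a i * ?L i) = A"
  proof -
    have "m \<le> n - r * d" "degree A \<le> n - r * d" using Suc.prems A(1) by auto
    from comb[OF this] show thesis using that by blast
  qed
  define A' where "A' = (\<Sum>i\<in>UNIV. smult (G i) (a i))"
  have "degree A' \<le> n - r * d - d"
    unfolding A'_def
  proof (rule degree_sum_le)
    fix i :: 3
    show "degree (smult (G i) (a i)) \<le> n - r * d - d"
      using degree_smult_le[of "G i" "a i"] a(1)[of i] by simp
  qed simp
  moreover have "d \<le> n - r * d" using a(1)[of undefined] by simp
  ultimately have deg': "degree A' + Suc r * d \<le> n" using A(1) by simp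
  have "smult (G z) A - ?L z * A' = (\<Sum>i\<in>UNIV. a i * koszul G z i)"
    unfolding a(2)[symmetric] A'_def
    by (simp only: koszul_def poly_module.scale_sum_right sum_distrib_left sum_subtractf[symmetric]
        smult_conv_mult right_diff_distrib mult_ac)
  also have "\<dots> \<in> koszul_span d G (n - r * d)"
    using a(1) by (intro poly_module.span_sum koszul_span_mult[OF koszul_in_span])
  finally have K: "smult (G z) A - ?L z * A' \<in> koszul_span d G (n - r * d)" .
  have "degree (?L z ^ r) \<le> r * d"
    by (rule degree_power_le_mult) (simp add: degree_lift_poly deg)
  then have "?L z ^ r * (smult (G z) A - ?L z * A') \<in> koszul_span d G n"
    using Suc.prems by (intro koszul_span_mult[OF K]) simp
  then have "smult (G z) (smult (G z ^ r) f - ?L z ^ r * A) + ?L z ^ r * (smult (G z) A - ?L z * A')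
      \<in> koszul_span d G n"
    by (intro poly_module.span_add poly_module.span_scale A(2))
  also have "smult (G z) (smult (G z ^ r) f - ?L z ^ r * A) + ?L z ^ r * (smult (G z) A - ?L z * A')
      = smult (G z ^ Suc r) f - ?L z ^ Suc r * A'"
  proof -
    have ring: "x * (k * f - Lr * A) + Lr * (x * A - Lz * A') = x * k * f - Lz * Lr * A'"
      for x k f Lr A Lz A' :: "'a poly poly"
      by (simp add: algebra_simps)
    show ?thesis by (simp only: smult_conv_mult power_Suc const_poly_mult ring)
  qed
  finally show ?case using deg' by blast
qed

section \<open>From an inverse to a nonzero minor\<close>

text \<open>The assumption \<open>inv\<close> says that \<open>F0\<close> and \<open>F1\<close> give a rational inverse in the coordinate \<open>t\<close>. It
  puts nonzero multiples of all \<open>(t - s) s\<^sup>b\<close> with \<open>b < N\<close> into the span of the Koszul rows; the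
  lowest exponent of such a multiple is \<open>b\<close>.\<close>

lemma inverse_imp_koszul_minor:
  fixes G :: "3 \<Rightarrow> 'a::field poly"
  assumes deg: "\<And>i. degree (G i) \<le> d" and z: "G z \<noteq> 0"
    and comb: "\<And>n b. m \<le> n \<Longrightarrow> b \<le> n \<Longrightarrow>
      \<exists>a. (\<forall>i. degree (a i) + d \<le> n) \<and> (\<Sum>i\<in>UNIV. a i * G i) = monom 1 b"
    and F: "is_form e F0" "is_form e F1"
    and inv: "eval_hom (\<lambda>c. [:c:]) G F0 * [:0, 1:] = eval_hom (\<lambda>c. [:c:]) G F1"
    and nz: "eval_hom (\<lambda>c. [:c:]) G F0 \<noteq> 0"
  shows "\<exists>N \<rho>. 0 < N \<and> (\<forall>i<N. fst (\<rho> i) + d \<le> N) \<and>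
    det (mat N N (\<lambda>(i, j). coeff (koszul_row G (\<rho> i)) j)) \<noteq> 0"
proof -
  let ?L = "\<lambda>i. lift_poly (G i)"
  interpret L: comm_ring_hom "lift_poly :: 'a poly \<Rightarrow> _" by (rule lift_poly_hom)
  define H0 where "H0 = eval_hom (\<lambda>c. [:c:]) G F0"
  define H1 where "H1 = eval_hom (\<lambda>c. [:c:]) G F1"
  have H1: "H1 = H0 * [:0, 1:]" using inv by (simp add: H0_def H1_def)
  define D :: "'a poly poly" where "D = [:[:0, 1:], - 1:]"
  have degD: "degree D = 1" by (simp add: D_def)
  have comb': "\<exists>a. (\<forall>i. degree (a i) + d \<le> n) \<and> (\<Sum>i\<in>UNIV. a i * ?L i) = f"
    if n: "m \<le> n" "degree f \<le> n" for n f
  proof -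
    have "\<forall>b. \<exists>a. b \<le> n \<longrightarrow> (\<forall>i. degree (a i) + d \<le> n) \<and> (\<Sum>i\<in>UNIV. a i * G i) = monom 1 b"
      using comb[OF n(1)] by blast
    then obtain a where a: "\<And>b i. b \<le> n \<Longrightarrow> degree (a b i) + d \<le> n"
        "\<And>b. b \<le> n \<Longrightarrow> (\<Sum>i\<in>UNIV. a b i * G i) = monom 1 b" by metis
    define c where "c i = (\<Sum>b\<le>n. smult (coeff f b) (lift_poly (a b i)))" for i
    have dn: "d \<le> n" using a(1)[of 0 undefined] by simp
    have "degree (c i) \<le> n - d" for i
      unfolding c_def
    proof (rule degree_sum_le)
      fix b assume "b \<in> {..n}"
      then show "degree (smult (coeff f b) (lift_poly (a b i))) \<le> n - d"
        using degree_smult_le[of "coeff f b" "lift_poly (a b i)"] a(1)[of b i]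
        by (simp add: degree_lift_poly)
    qed simp
    then have "degree (c i) + d \<le> n" for i using dn by (metis add_le_mono1 le_add_diff_inverse2)
    moreover have "(\<Sum>i\<in>UNIV. c i * ?L i) = f"
    proof -
      have "(\<Sum>i\<in>UNIV. c i * ?L i) = (\<Sum>b\<le>n. smult (coeff f b) (lift_poly (\<Sum>i\<in>UNIV. a b i * G i)))"
        unfolding c_def sum_distrib_right
        by (subst sum.swap) (simp add: L.hom_sum L.hom_mult poly_module.scale_sum_right)
      also have "\<dots> = (\<Sum>b\<le>n. monom (coeff f b) b)"
        by (intro sum.cong refl) (simp add: a(2) lift_poly_monom smult_monom)
      also have "\<dots> = f" using n(2) by (rule poly_as_sum_of_monoms')
      finally show ?thesis .
    qed
    ultimately show ?thesis by blast
  qed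
  \<comment> \<open>Trading \<open>e\<close> factors in polynomials of degree \<open>N - 1\<close> needs \<open>m + e * d \<le> N - 1\<close>; the factor
    \<open>t - s\<close> raises the degree to \<open>N\<close>.\<close>
  define N where "N = m + e * d + 1"
  have key: "smult (G z ^ e * H0) (monom 1 b * D) \<in> koszul_span d G N" if b: "b < N" for b
  proof -
    define f :: "'a poly poly" where "f = monom 1 b"
    have "degree f \<le> N - 1" using b degree_monom_le[of 1 b] by (auto simp: f_def degree_monom_eq)
    then obtain A where A: "degree A + e * d \<le> N - 1"
        "smult (G z ^ e) f - ?L z ^ e * A \<in> koszul_span d G (N - 1)"
      using koszul_trade_powers[where G = G and m = m and n = "N - 1" and f = f and z = z and r = e,
          OF deg comb'] by (auto simp: N_def)
    have degAD: "degree (A * D) + e * d \<le> N"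
      using degree_mult_le[of A D] A(1) b by (simp add: degD)
    have "degree (smult H0 D) \<le> 1" using degree_smult_le[of H0 D] degD by simp
    then have 1: "smult H0 D * (smult (G z ^ e) f - ?L z ^ e * A) \<in> koszul_span d G N"
      using b by (intro koszul_span_mult[OF A(2)]) simp
    have 2: "(A * D) * (smult (G z ^ e) (lift_poly H0) - ?L z ^ e * [:H0:]) \<in> koszul_span d G N"
      using koszul_subst[where z = z, OF deg F(1)] degAD unfolding H0_def by (rule koszul_span_mult)
    have degA: "degree A + e * d \<le> N" "degree (smult [:0, 1:] A) + e * d \<le> N"
      using A(1) degree_smult_le[of "[:0, 1:]" A] by auto
    have 3: "smult [:0, 1:] A * (smult (G z ^ e) (lift_poly H0) - ?L z ^ e * [:H0:]) \<in> koszul_span d G N"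
      using koszul_subst[where z = z, OF deg F(1)] degA(2) unfolding H0_def by (rule koszul_span_mult)
    have 4: "A * (smult (G z ^ e) (lift_poly H1) - ?L z ^ e * [:H1:]) \<in> koszul_span d G N"
      using koszul_subst[where z = z, OF deg F(2)] degA(1) unfolding H1_def by (rule koszul_span_mult)
    have lH1: "lift_poly H1 = lift_poly H0 * [:0, 1:]"
    proof -
      have "lift_poly [:0, 1:] = ([:0, 1:] :: 'a poly poly)"
        by (rule poly_eqI) (simp add: coeff_lift_poly coeff_pCons split: nat.split)
      then show ?thesis unfolding H1 L.hom_mult by simp
    qed
    \<comment> \<open>Each of the four terms is a multiple of a congruence above; what they leave over is a multiple
      of \<open>t H0(t) - H1(t) = 0\<close>.\<close>
    have "smult (G z ^ e * H0) (f * D) = smult H0 D * (smult (G z ^ e) f - ?L z ^ e * A)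
       - (A * D) * (smult (G z ^ e) (lift_poly H0) - ?L z ^ e * [:H0:])
       + smult [:0, 1:] A * (smult (G z ^ e) (lift_poly H0) - ?L z ^ e * [:H0:])
       - A * (smult (G z ^ e) (lift_poly H1) - ?L z ^ e * [:H1:])"
    proof -
      have ring: "k * h * (f * (t - s)) = h * (t - s) * (k * f - Le * A)
          - A * (t - s) * (k * lh - Le * h) + t * A * (k * lh - Le * h)
          - A * (k * (lh * s) - Le * (h * t))" for k h f t s Le A lh :: "'a poly poly"
        by (simp add: algebra_simps)
      have D': "D = [:[:0, 1:]:] - [:0, 1:]" by (simp add: D_def)
      have H1': "[:H1:] = [:H0:] * [:[:0, 1:]:]" by (simp add: H1)
      show ?thesis
        unfolding lH1 H1' D' smult_conv_mult const_poly_mult by (rule ring)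
    qed
    then show ?thesis
      using poly_module.span_diff[OF poly_module.span_add[OF poly_module.span_diff[OF 1 2] 3] 4]
      by (simp add: f_def)
  qed
  have coeff_key: "coeff (smult c (monom 1 b * D)) j = c * (if j < b then 0 else coeff D (j - b))" for c b j
    by (simp add: coeff_monom_mult)
  have fin: "finite (koszul_rows d G N)"
    unfolding koszul_rows_def by (intro finite_imageI finite_shifts)
  have "\<exists>\<rho>. (\<forall>i<N. \<rho> i \<in> koszul_rows d G N) \<and> det (mat N N (\<lambda>(i, j). coeff (\<rho> i) j)) \<noteq> 0"
  proof (rule exists_nonzero_minor[OF fin key])
    show "coeff (smult (G z ^ e * H0) (monom 1 b * D)) b \<noteq> 0" for b
      using z nz unfolding coeff_key by (simp add: D_def H0_def)
    show "coeff (smult (G z ^ e * H0) (monom 1 b * D)) j = 0" if "j < b" for b j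
      using that unfolding coeff_key by simp
  qed
  then obtain \<rho> where \<rho>: "\<And>i. i < N \<Longrightarrow> \<rho> i \<in> koszul_rows d G N"
    and det: "det (mat N N (\<lambda>(i, j). coeff (\<rho> i) j)) \<noteq> 0" by blast
  have "\<exists>s. fst s + d \<le> N \<and> \<rho> i = koszul_row G s" if "i < N" for i
    using \<rho>[OF that] unfolding koszul_rows_def by force
  then obtain s where s: "\<And>i. i < N \<Longrightarrow> fst (s i) + d \<le> N \<and> \<rho> i = koszul_row G (s i)" by metis
  have "mat N N (\<lambda>(i, j). coeff (\<rho> i) j) = mat N N (\<lambda>(i, j). coeff (koszul_row G (s i)) j)"
    by (rule eq_matI) (use s in auto)
  moreover have "0 < N" by (simp add: N_def)
  ultimately show ?thesis using det s by metis
qed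

section \<open>From a nonzero minor to an inverse\<close>

lemma is_form_det:
  fixes T :: "('v, 'a::comm_ring_1) mpoly mat"
  assumes T: "T \<in> carrier_mat n n" and form: "\<And>i j. i < n \<Longrightarrow> j < n \<Longrightarrow> is_form 1 (T $$ (i, j))"
  shows "is_form n (det T)"
  unfolding det_def'[OF T]
proof (rule is_form_sum)
  fix p assume "p \<in> {p. p permutes {0..<n}}"
  then have "p i < n" if "i < n" for i
    using that permutes_in_image[of p "{0..<n}" i] by auto
  then have "is_form (\<Sum>i=0..<n. 1) (\<Prod>i=0..<n. T $$ (i, p i))"
    by (intro is_form_prod form) auto
  then have prod: "is_form n (\<Prod>i=0..<n. T $$ (i, p i))" by simp
  show "is_form n (signof p * (\<Prod>i=0..<n. T $$ (i, p i)))"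
    using prod is_form_uminus[OF prod] by (cases "sign p = 1") (auto simp: sign_def)
qed

lemma coeff_koszul_row:
  fixes G :: "3 \<Rightarrow> 'a::comm_ring_1 poly"
  shows "coeff (koszul_row G (a, i, j)) l =
     G i * [:coeff (monom 1 a * G j) l:] - G j * [:coeff (monom 1 a * G i) l:]"
proof -
  interpret L: comm_ring_hom "lift_poly :: 'a poly \<Rightarrow> _" by (rule lift_poly_hom)
  have "koszul_row G (a, i, j) =
      smult (G i) (lift_poly (monom 1 a * G j)) - smult (G j) (lift_poly (monom 1 a * G i))"
    by (simp add: koszul_row_def koszul_def lift_poly_monom L.hom_mult
        right_diff_distrib one_pCons)
  then show ?thesis by (simp only: coeff_diff coeff_smult coeff_lift_poly)
qed

lemma degree_koszul_row:
  fixes G :: "3 \<Rightarrow> 'a::comm_ring_1 poly"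
  assumes "\<And>i. degree (G i) \<le> d" "fst s + d \<le> n"
  shows "degree (koszul_row G s) \<le> n"
proof -
  obtain a i j where s: "s = (a, i, j)" by (cases s)
  have "degree (monom 1 a * G k) \<le> n" for k
  proof -
    have "a + d \<le> n" using assms(2) by (simp add: s)
    then show ?thesis
      using degree_mult_le[of "monom 1 a" "G k"] degree_monom_le[of "1::'a" a] assms(1)[of k] by linarith
  qed
  then have "coeff (monom 1 a * G k) l = 0" if "n < l" for k l
    using that by (meson coeff_eq_0 le_less_trans)
  then show ?thesis
    unfolding s by (intro degree_le allI impI) (simp add: coeff_koszul_row)
qed

lemma poly_koszul_row: "poly (koszul_row G s) [:0, 1:] = 0"
  by (simp add: koszul_row_def koszul_def case_prod_beta poly_lift_poly)

text \<open>The coefficients of a Koszul row are linear forms in \<open>G\<^sub>1, G\<^sub>2, G\<^sub>3\<close> whose coefficients are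
  constants. The entry is this linear form in the homogeneous coordinates of the plane.\<close>

definition generic_koszul_entry ::
    "(3 \<Rightarrow> 'a::comm_ring_1 poly) \<Rightarrow> nat \<times> 3 \<times> 3 \<Rightarrow> nat \<Rightarrow> (3, 'a) mpoly" where
  "generic_koszul_entry G = (\<lambda>(a, i, j) l.
     Const (coeff (monom 1 a * G j) l) * Var i - Const (coeff (monom 1 a * G i) l) * Var j)"

lemma is_form_generic_koszul_entry: "is_form 1 (generic_koszul_entry G s l)"
  unfolding generic_koszul_entry_def case_prod_beta
  by (intro is_form_diff is_form_Const_mult is_form_Var)

lemma eval_generic_koszul_entry:
  "eval_hom (\<lambda>c. [:c:]) G (generic_koszul_entry G s l) = coeff (koszul_row G s) l"
proof -
  interpret comm_ring_hom "eval_hom (\<lambda>c. [:c:]) G"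
    by (rule comm_ring_hom_eval_hom[OF comm_ring_hom_const_poly])
  show ?thesis
    by (cases s) (simp add: generic_koszul_entry_def coeff_koszul_row hom_minus hom_mult)
qed

text \<open>Every row annihilates \<open>(1, t, \<dots>, t\<^sup>N)\<close>. So \<open>(1, \<dots>, t\<^bsup>N - 1\<^esup>)\<close> solves the square system of the
  columns \<open>0, \<dots>, N - 1\<close> whose right-hand side is \<open>- t\<^sup>N\<close> times the column \<open>N\<close>. Cramer's rule for the
  last coordinate shows that the minors with columns \<open>0, \<dots>, N - 1\<close> and \<open>0, \<dots>, N - 2, N\<close> have
  the ratio \<open>- t\<close>.\<close>

lemma koszul_minor_imp_inverse:
  fixes G :: "3 \<Rightarrow> 'a::field poly"
  assumes deg: "\<And>i. degree (G i) \<le> d" and N: "0 < N" and \<rho>: "\<And>i. i < N \<Longrightarrow> fst (\<rho> i) + d \<le> N"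
    and nz: "det (mat N N (\<lambda>(i, j). coeff (koszul_row G (\<rho> i)) j)) \<noteq> 0"
  shows "\<exists>F0 F1. is_form N F0 \<and> is_form N F1 \<and> eval_hom (\<lambda>c. [:c:]) G F0 \<noteq> 0 \<and>
    eval_hom (\<lambda>c. [:c:]) G F0 * [:0, 1:] = eval_hom (\<lambda>c. [:c:]) G F1"
proof -
  define \<phi> where "\<phi> = eval_hom (\<lambda>c. [:c:]) G"
  interpret \<phi>: comm_ring_hom \<phi>
    unfolding \<phi>_def by (rule comm_ring_hom_eval_hom[OF comm_ring_hom_const_poly])
  define t :: "'a poly" where "t = [:0, 1:]"
  define P where "P = mat N N (\<lambda>(i, j). coeff (koszul_row G (\<rho> i)) j)"
  define c where "c = vec N (\<lambda>i. coeff (koszul_row G (\<rho> i)) N)"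
  define q where "q = vec N (\<lambda>l. t ^ l)"
  have P: "P \<in> carrier_mat N N" and c: "c \<in> carrier_vec N" and q: "q \<in> carrier_vec N"
    by (simp_all add: P_def c_def q_def)
  have "mult_mat_vec P q = smult_vec (- (t ^ N)) c"
  proof (rule eq_vecI)
    fix i assume "i < dim_vec (smult_vec (- (t ^ N)) c)"
    then have i: "i < N" by (simp add: c_def)
    let ?r = "koszul_row G (\<rho> i)"
    have "poly ?r t = poly (\<Sum>l\<le>N. monom (coeff ?r l) l) t"
      by (simp add: poly_as_sum_of_monoms'[OF degree_koszul_row[of G d, OF deg \<rho>[OF i]]])
    also have "\<dots> = (\<Sum>l\<le>N. coeff ?r l * t ^ l)"
      by (simp add: poly_sum poly_monom)
    also have "\<dots> = (\<Sum>l<N. coeff ?r l * t ^ l) + coeff ?r N * t ^ N"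
      by (simp flip: lessThan_Suc_atMost)
    finally have "(\<Sum>l<N. coeff ?r l * t ^ l) = - (coeff ?r N * t ^ N)"
      unfolding t_def poly_koszul_row by (simp add: eq_neg_iff_add_eq_0)
    then show "mult_mat_vec P q $ i = smult_vec (- (t ^ N)) c $ i"
      using i by (simp add: P_def q_def c_def scalar_prod_def lessThan_atLeast0 mult.commute)
  qed (simp add: P_def c_def)
  then have "- (t ^ N) * det (replace_col P c (N - 1)) = q $ (N - 1) * det P"
    using cramer_lemma_mat[OF P q, of "N - 1"] det_replace_col_smult[OF P c, of "N - 1" "- (t ^ N)"] N
    by simp
  moreover have "q $ (N - 1) = t ^ (N - 1)" "t ^ N = t ^ (N - 1) * t"
    using N by (simp_all add: q_def flip: power_Suc2)
  ultimately have "t ^ (N - 1) * (- det (replace_col P c (N - 1)) * t) = t ^ (N - 1) * det P"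
    by (simp add: mult_ac)
  moreover have "t ^ (N - 1) \<noteq> 0" by (simp add: t_def)
  ultimately have cramer: "- det (replace_col P c (N - 1)) * t = det P"
    by (simp only: mult_cancel_left) simp
  \<comment> \<open>The two minors are the values at \<open>G\<close> of determinants of linear forms.\<close>
  define T where "T = mat N N (\<lambda>(i, j). generic_koszul_entry G (\<rho> i) j)"
  define T' where "T' = mat N N (\<lambda>(i, j). generic_koszul_entry G (\<rho> i) (if j = N - 1 then N else j))"
  have "map_mat \<phi> T = P"
    by (rule eq_matI) (simp_all add: T_def P_def \<phi>_def eval_generic_koszul_entry)
  then have T: "\<phi> (det T) = det P" by (metis \<phi>.hom_det)
  have "map_mat \<phi> T' = replace_col P c (N - 1)"
    by (rule eq_matI)
      (auto simp: T'_def P_def c_def replace_col_def \<phi>_def eval_generic_koszul_entry)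
  then have T': "\<phi> (det T') = det (replace_col P c (N - 1))" by (metis \<phi>.hom_det)
  have "is_form N (det T)" "is_form N (- det T')"
    by (intro is_form_uminus is_form_det, simp_all add: T_def T'_def is_form_generic_koszul_entry[simplified])+
  moreover have "\<phi> (- det T') * t = \<phi> (det T)" using cramer T T' by (simp add: \<phi>.hom_uminus)
  moreover have "\<phi> (det T) \<noteq> 0" unfolding T P_def by (rule nz)
  ultimately show ?thesis unfolding \<phi>_def t_def by (metis mult_zero_left)
qed

section \<open>The minors that detect birationality\<close>

lemma dehom_subst:
  "dehom z (subst g F) = eval_hom (\<lambda>c. [:c:]) (\<lambda>i. dehom z (g i)) (F :: ('v, 'a::comm_ring_1) mpoly)"
  unfolding subst_def by (simp add: hom_eval_hom[OF dehom_hom] dehom_Const)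

lemma base_point_free_nonzero:
  fixes g :: "3 \<Rightarrow> (2, 'a::field) mpoly"
  assumes "base_points g = {}" shows "\<exists>i. g i \<noteq> 0"
proof (rule ccontr)
  assume "\<not> ?thesis"
  then have "{0} \<in> base_points g" by (simp add: base_points_iff zero_in_Proj)
  with assms show False by simp
qed

lemma birational_imp_koszul_minor:
  fixes g :: "3 \<Rightarrow> (2, 'a::field) mpoly"
  assumes g: "g \<in> triples d" and d: "d > 0" and bpf: "base_points g = {}"
    and bir: "birational_onto_image g"
  shows "\<exists>N \<rho>. 0 < N \<and> (\<forall>i<N. fst (\<rho> i) + d \<le> N) \<and>
    det (mat N N (\<lambda>(i, j). coeff (koszul_row (\<lambda>i. dehom 0 (g i)) (\<rho> i)) j)) \<noteq> 0"
proof -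
  have gf: "is_form d (g i)" for i using g by (simp add: triples_def)
  interpret D: comm_ring_hom "dehom 0 :: (2, 'a) mpoly \<Rightarrow> _" by (rule dehom_hom)
  have dehom0: "F = 0" if "is_form n F" "dehom 0 F = 0" for n and F :: "(2, 'a) mpoly"
    using dehom_inject[OF that(1) is_form_0, of 0] that(2) by simp
  obtain z where z: "g z \<noteq> 0" using base_point_free_nonzero[OF bpf] by blast
  obtain h e w where h: "\<And>i. is_form e (h i)" and w: "subst g (h w) \<noteq> 0"
    and ratio: "\<And>i j. subst g (h i) * Var j = subst g (h j) * Var i"
    using bir birational_onto_image_iff[OF g d base_point_free_nonzero[OF bpf]] by blast
  have "subst g (h 0) \<noteq> 0"
    using ratio[of w 0] w by auto
  then have nz: "dehom 0 (subst g (h 0)) \<noteq> 0"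
    using dehom0[OF is_form_subst[where v = g, OF gf h]] by blast
  have inv: "dehom 0 (subst g (h 0)) * [:0, 1:] = dehom 0 (subst g (h 1))"
    using arg_cong[OF ratio[of 0 1], of "dehom 0"]
    by (simp add: D.hom_mult dehom_Var(1) dehom_Var(2)[of 0, simplified])
  obtain m where m: "\<And>n b. m \<le> n \<Longrightarrow> b \<le> n \<Longrightarrow>
    \<exists>a. (\<forall>i. degree (a i) + d \<le> n) \<and> (\<Sum>i\<in>UNIV. a i * dehom 0 (g i)) = monom 1 b"
    using base_point_free_imp_combination[OF g bpf] by blast
  show ?thesis
  proof (rule inverse_imp_koszul_minor)
    show "dehom 0 (g z) \<noteq> 0" using z dehom0[OF gf] by blast
    show "degree (dehom 0 (g i)) \<le> d" for i by (rule degree_dehom[OF gf])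
    show "is_form e (h 0)" "is_form e (h 1)" by (rule h)+
  qed (use m nz inv in \<open>simp_all add: dehom_subst\<close>)
qed

lemma koszul_minor_imp_birational:
  fixes g :: "3 \<Rightarrow> (2, 'a::field) mpoly"
  assumes g: "g \<in> triples d" and d: "d > 0" and bpf: "base_points g = {}"
    and N: "0 < N" and \<rho>: "\<And>i. i < N \<Longrightarrow> fst (\<rho> i) + d \<le> N"
    and nz: "det (mat N N (\<lambda>(i, j). coeff (koszul_row (\<lambda>i. dehom 0 (g i)) (\<rho> i)) j)) \<noteq> 0"
  shows "birational_onto_image g"
proof -
  have gf: "is_form d (g i)" for i using g by (simp add: triples_def)
  interpret D: comm_ring_hom "dehom 0 :: (2, 'a) mpoly \<Rightarrow> _" by (rule dehom_hom)
  obtain F0 F1 where F: "is_form N F0" "is_form N F1" and nz': "dehom 0 (subst g F0) \<noteq> 0"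
    and inv: "dehom 0 (subst g F0) * [:0, 1:] = dehom 0 (subst g F1)"
    using koszul_minor_imp_inverse[where \<rho> = \<rho>, OF degree_dehom[OF gf] N \<rho> nz] unfolding dehom_subst by blast
  define h where "h i = (if i = 0 then F0 else F1)" for i :: 2
  have h: "is_form N (h i)" for i using F by (simp add: h_def)
  have "subst g F0 * Var 1 = subst g F1 * Var 0"
  proof (rule dehom_inject)
    show "is_form (N * d + 1) (subst g F0 * Var 1)" "is_form (N * d + 1) (subst g F1 * Var 0)"
      by (intro is_form_mult is_form_subst gf F is_form_Var)+
    show "dehom 0 (subst g F0 * Var 1) = dehom 0 (subst g F1 * Var 0)"
      using inv by (simp add: D.hom_mult dehom_Var(1) dehom_Var(2)[of 0, simplified])
  qed
  then have "subst g (h i) * Var j = subst g (h j) * Var i" for i j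
    using two_cases[of i 0] two_cases[of j 0] by (auto simp: h_def)
  moreover have "subst g (h 0) \<noteq> 0" using nz' by (auto simp: h_def)
  ultimately show ?thesis
    using birational_onto_image_iff[OF g d base_point_free_nonzero[OF bpf]] h by blast
qed

section \<open>Regular functions on the space of triples\<close>

definition regular_function :: "nat \<Rightarrow> ((3 \<Rightarrow> (2, 'a::field) mpoly) \<Rightarrow> 'a) \<Rightarrow> bool" where
  "regular_function d f \<longleftrightarrow> (\<exists>P\<in>coord_ring d. \<forall>g\<in>triples d. f g = eval_at (coeffs g) P)"

lemma regular_const: "regular_function d (\<lambda>g. c)"
  unfolding regular_function_def
proof (intro bexI[of _ "Const c"] ballI)
  show "Const c \<in> coord_ring d" by (auto simp: coord_ring_def vars_def Const_def)
qed (simp add: Const_def eval_at_single)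

lemma regular_add:
  assumes "regular_function d f" "regular_function d f'"
  shows "regular_function d (\<lambda>g. f g + f' g)"
proof -
  obtain P Q where "P \<in> coord_ring d" "\<forall>g\<in>triples d. f g = eval_at (coeffs g) P"
    "Q \<in> coord_ring d" "\<forall>g\<in>triples d. f' g = eval_at (coeffs g) Q"
    using assms unfolding regular_function_def by blast
  moreover from this have "P + Q \<in> coord_ring d"
    using Poly_Mapping.keys_add[of P Q] unfolding coord_ring_def vars_def by blast
  ultimately show ?thesis
    unfolding regular_function_def by (intro bexI[of _ "P + Q"]) (simp_all add: eval_at_add)
qed

lemma regular_mult:
  assumes "regular_function d f" "regular_function d f'"
  shows "regular_function d (\<lambda>g. f g * f' g)"
proof -
  obtain P Q where "P \<in> coord_ring d" "\<forall>g\<in>triples d. f g = eval_at (coeffs g) P"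
    "Q \<in> coord_ring d" "\<forall>g\<in>triples d. f' g = eval_at (coeffs g) Q"
    using assms unfolding regular_function_def by blast
  moreover from this have "P * Q \<in> coord_ring d"
    using vars_mult[of P Q] unfolding coord_ring_def by blast
  ultimately show ?thesis
    unfolding regular_function_def by (intro bexI[of _ "P * Q"]) (simp_all add: eval_at_mult)
qed

lemma regular_sum: "(\<And>x. x \<in> A \<Longrightarrow> regular_function d (f x)) \<Longrightarrow> regular_function d (\<lambda>g. \<Sum>x\<in>A. f x g)"
  by (induction A rule: infinite_finite_induct) (simp_all add: regular_const regular_add)

lemma regular_prod: "(\<And>x. x \<in> A \<Longrightarrow> regular_function d (f x)) \<Longrightarrow> regular_function d (\<lambda>g. \<Prod>x\<in>A. f x g)"
  by (induction A rule: infinite_finite_induct) (simp_all add: regular_const regular_mult)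

lemma regular_diff:
  assumes "regular_function d f" "regular_function d f'"
  shows "regular_function d (\<lambda>g. f g - f' g)"
  using regular_add[OF assms(1) regular_mult[OF regular_const[of d "- 1"] assms(2)]] by simp

lemma regular_coeff: "regular_function d (\<lambda>g. coeff (dehom 0 (g i)) l)"
proof (cases "l \<le> d")
  case True
  show ?thesis
    unfolding regular_function_def
  proof (intro bexI[of _ "Var (i, mono2 0 d l)"] ballI)
    show "Var (i, mono2 0 d l) \<in> coord_ring d"
      using True by (auto simp: coord_ring_def vars_def Var_def mdeg_mono2)
    show "coeff (dehom 0 (g i)) l = eval_at (coeffs g) (Var (i, mono2 0 d l))" if "g \<in> triples d" for g
      using that True coeff_dehom[of d "g i" 0 l]
      by (simp add: triples_def Var_def eval_at_single mono_eval_single coeffs_def)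
  qed
next
  case False
  have "coeff (dehom 0 (g i)) l = 0" if "g \<in> triples d" for g
    using that False coeff_dehom[of d "g i" 0 l] by (simp add: triples_def)
  then show ?thesis
    unfolding regular_function_def
    by (intro bexI[of _ 0] ballI) (simp_all add: coord_ring_def vars_def)
qed

text \<open>Minors of Koszul rows are polynomials in \<open>t\<close>; they depend on the triple through their
  coefficients.\<close>

definition regular_poly :: "nat \<Rightarrow> ((3 \<Rightarrow> (2, 'a::field) mpoly) \<Rightarrow> 'a poly) \<Rightarrow> bool" where
  "regular_poly d f \<longleftrightarrow> (\<forall>l. regular_function d (\<lambda>g. coeff (f g) l))"

lemma regular_poly_dehom: "regular_poly d (\<lambda>g. dehom 0 (g i))"
  by (simp add: regular_poly_def regular_coeff)

lemma regular_poly_const: "regular_poly d (\<lambda>g. p)"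
  by (simp add: regular_poly_def regular_const)

lemma regular_poly_mult:
  "regular_poly d f \<Longrightarrow> regular_poly d f' \<Longrightarrow> regular_poly d (\<lambda>g. f g * f' g)"
  unfolding regular_poly_def coeff_mult by (intro allI regular_sum regular_mult) auto

lemma regular_poly_diff:
  "regular_poly d f \<Longrightarrow> regular_poly d f' \<Longrightarrow> regular_poly d (\<lambda>g. f g - f' g)"
  unfolding regular_poly_def coeff_diff by (intro allI regular_diff) auto

lemma regular_poly_sum:
  "(\<And>x. x \<in> A \<Longrightarrow> regular_poly d (f x)) \<Longrightarrow> regular_poly d (\<lambda>g. \<Sum>x\<in>A. f x g)"
  unfolding regular_poly_def coeff_sum by (intro allI regular_sum) auto

lemma regular_poly_prod:
  "(\<And>x. x \<in> A \<Longrightarrow> regular_poly d (f x)) \<Longrightarrow> regular_poly d (\<lambda>g. \<Prod>x\<in>A. f x g)"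
  by (induction A rule: infinite_finite_induct) (simp_all add: regular_poly_const regular_poly_mult)

lemma regular_poly_constant_term:
  "regular_function d f \<Longrightarrow> regular_poly d (\<lambda>g. [:f g:])"
  unfolding regular_poly_def
proof
  fix l assume "regular_function d f"
  then show "regular_function d (\<lambda>g. coeff [:f g:] l)"
    by (cases l) (simp_all add: regular_const)
qed

lemma regular_det:
  assumes "\<And>i j. i < n \<Longrightarrow> j < n \<Longrightarrow> regular_function d (\<lambda>g. M g i j)"
  shows "regular_function d (\<lambda>g. det (mat n n (\<lambda>(i, j). M g i j)))"
proof -
  have "det (mat n n (\<lambda>(i, j). M g i j)) =
      (\<Sum>p | p permutes {0..<n}. signof p * (\<Prod>i=0..<n. M g i (p i)))" for g
    by (subst det_def'[of _ n]) (auto intro!: sum.cong prod.cong arg_cong2[of _ _ _ _ "(*)"])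
  then show ?thesis
    using assms by (auto intro!: regular_sum regular_mult regular_const regular_prod)
qed

lemma regular_poly_det:
  assumes "\<And>i j. i < n \<Longrightarrow> j < n \<Longrightarrow> regular_poly d (\<lambda>g. M g i j)"
  shows "regular_poly d (\<lambda>g. det (mat n n (\<lambda>(i, j). M g i j)))"
proof -
  have "det (mat n n (\<lambda>(i, j). M g i j)) =
      (\<Sum>p | p permutes {0..<n}. signof p * (\<Prod>i=0..<n. M g i (p i)))" for g
    by (subst det_def'[of _ n]) (auto intro!: sum.cong prod.cong arg_cong2[of _ _ _ _ "(*)"])
  then show ?thesis
    using assms by (auto intro!: regular_poly_sum regular_poly_mult regular_poly_const regular_poly_prod)
qed

lemma regular_coeff_multiple_row:
  "regular_function d (\<lambda>g :: 3 \<Rightarrow> (2, 'a::field) mpoly. coeff (multiple_row (\<lambda>i. dehom 0 (g i)) s) j)"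
proof -
  have "regular_poly d (\<lambda>g :: 3 \<Rightarrow> (2, 'a) mpoly. multiple_row (\<lambda>i. dehom 0 (g i)) s)"
    unfolding multiple_row_def case_prod_beta
    by (intro regular_poly_mult regular_poly_const regular_poly_dehom)
  then show ?thesis by (simp add: regular_poly_def)
qed

lemma regular_poly_coeff_koszul_row:
  "regular_poly d (\<lambda>g :: 3 \<Rightarrow> (2, 'a::field) mpoly. coeff (koszul_row (\<lambda>i. dehom 0 (g i)) s) l)"
proof -
  obtain a i j where s: "s = (a, i, j)" by (cases s)
  have "regular_function d (\<lambda>g :: 3 \<Rightarrow> (2, 'a) mpoly. coeff (monom 1 a * dehom 0 (g k)) l)" for k
  proof -
    have "regular_poly d (\<lambda>g :: 3 \<Rightarrow> (2, 'a) mpoly. monom 1 a * dehom 0 (g k))"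
      by (intro regular_poly_mult regular_poly_const regular_poly_dehom)
    then show ?thesis by (simp add: regular_poly_def)
  qed
  then show ?thesis
    unfolding s coeff_koszul_row
    by (intro regular_poly_diff regular_poly_mult regular_poly_dehom regular_poly_constant_term)
qed

text \<open>The principal open sets \<open>f \<noteq> 0\<close> are a basis, so it suffices to find one around each point.\<close>

lemma openin_zariski_if_nonvanishing:
  fixes U :: "(3 \<Rightarrow> (2, 'a::field) mpoly) set"
  assumes "U \<subseteq> triples d"
    and nbhd: "\<And>g. g \<in> U \<Longrightarrow> \<exists>f. regular_function d f \<and> f g \<noteq> 0 \<and> (\<forall>g'\<in>triples d. f g' \<noteq> 0 \<longrightarrow> g' \<in> U)"
  shows "openin (zariski d) U"
  unfolding openin_zariski
proof (intro conjI exI[of _ "{P \<in> coord_ring d. \<forall>g\<in>triples d - U. eval_at (coeffs g) P = 0}"])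
  let ?S = "{P \<in> coord_ring d. \<forall>g\<in>triples d - U. eval_at (coeffs g) P = 0}"
  show "triples d - U = coeff_zeros d ?S"
  proof (intro equalityI subsetI)
    fix g assume g: "g \<in> coeff_zeros d ?S"
    then have gt: "g \<in> triples d" by (simp add: coeff_zeros_def)
    moreover have "g \<notin> U"
    proof
      assume "g \<in> U"
      then obtain f where f: "regular_function d f" "f g \<noteq> 0" "\<forall>g'\<in>triples d. f g' \<noteq> 0 \<longrightarrow> g' \<in> U"
        using nbhd by blast
      then obtain P where P: "P \<in> coord_ring d" "\<forall>g\<in>triples d. f g = eval_at (coeffs g) P"
        unfolding regular_function_def by blast
      have "P \<in> ?S" using P f(3) by auto
      then have "eval_at (coeffs g) P = 0" using g unfolding coeff_zeros_def by blast
      then show False using f(2) P(2) gt by simp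
    qed
    ultimately show "g \<in> triples d - U" by blast
  qed (auto simp: coeff_zeros_def)
qed (use assms in auto)

theorem theorem5p20:
  fixes d :: nat
  assumes "d > 0"
  shows "openin (zariski d) (birational_bpf d :: (3 \<Rightarrow> (2, 'a::field) mpoly) set)"
proof (rule openin_zariski_if_nonvanishing)
  show "birational_bpf d \<subseteq> (triples d :: (3 \<Rightarrow> (2, 'a) mpoly) set)"
    by (auto simp: birational_bpf_def)
next
  fix g :: "3 \<Rightarrow> (2, 'a) mpoly" assume "g \<in> birational_bpf d"
  then have g: "g \<in> triples d" and bir: "birational_onto_image g" and bpf: "base_points g = {}"
    by (auto simp: birational_bpf_def)
  obtain n \<rho> where \<rho>: "\<And>i. i \<le> n \<Longrightarrow> fst (\<rho> i) + d \<le> n"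
    and nz: "det (mat (Suc n) (Suc n) (\<lambda>(i, j). coeff (multiple_row (\<lambda>i. dehom 0 (g i)) (\<rho> i)) j)) \<noteq> 0"
    using base_point_free_imp_minor[OF g bpf] by blast
  obtain N \<sigma> where N: "0 < N" and \<sigma>: "\<And>i. i < N \<Longrightarrow> fst (\<sigma> i) + d \<le> N"
    and nz': "det (mat N N (\<lambda>(i, j). coeff (koszul_row (\<lambda>i. dehom 0 (g i)) (\<sigma> i)) j)) \<noteq> 0"
    using birational_imp_koszul_minor[OF g assms bpf bir] by blast
  define D where "D g = det (mat (Suc n) (Suc n) (\<lambda>(i, j). coeff (multiple_row (\<lambda>i. dehom 0 (g i)) (\<rho> i)) j))"
    for g :: "3 \<Rightarrow> (2, 'a) mpoly"
  define K where "K g = det (mat N N (\<lambda>(i, j). coeff (koszul_row (\<lambda>i. dehom 0 (g i)) (\<sigma> i)) j))"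
    for g :: "3 \<Rightarrow> (2, 'a) mpoly"
  \<comment> \<open>A single coefficient of the Koszul minor already certifies that the minor is nonzero.\<close>
  obtain l where l: "coeff (K g) l \<noteq> 0" using nz' unfolding K_def by (metis leading_coeff_0_iff)
  have "regular_function d D"
    unfolding D_def by (intro regular_det regular_coeff_multiple_row)
  moreover have "regular_poly d K"
    unfolding K_def by (intro regular_poly_det regular_poly_coeff_koszul_row)
  ultimately have "regular_function d (\<lambda>g. D g * coeff (K g) l)"
    by (intro regular_mult) (simp_all add: regular_poly_def)
  moreover have "D g * coeff (K g) l \<noteq> 0" using nz l by (simp add: D_def)
  moreover have "g' \<in> birational_bpf d" if g': "g' \<in> triples d" "D g' * coeff (K g') l \<noteq> 0" for g'
  proof -
    have "D g' \<noteq> 0" "K g' \<noteq> 0" using g'(2) by auto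
    then have bpf': "base_points g' = {}"
      using minor_imp_base_point_free[where \<rho> = \<rho> and n = n, OF g'(1) \<rho>] unfolding D_def by blast
    moreover have "birational_onto_image g'"
      using koszul_minor_imp_birational[where \<rho> = \<sigma>, OF g'(1) assms bpf' N \<sigma>] \<open>K g' \<noteq> 0\<close> unfolding K_def by blast
    ultimately show ?thesis using g'(1) by (simp add: birational_bpf_def)
  qed
  ultimately show "\<exists>f. regular_function d f \<and> f g \<noteq> 0 \<and> (\<forall>g'\<in>triples d. f g' \<noteq> 0 \<longrightarrow> g' \<in> birational_bpf d)"
    by blast
qed

end
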